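(* Every $C^{1+bv}$ (orientation-preserving) circle diffeomorphism $f$ of irrational rotation number that has absolutely continuous derivative is $C^1$ rigid. More precisely, the sequence $f^{q_n}$ converges to the identity in the $C^1$ topology, where $(q_n)$ is the sequence of denominators of the rational approximations of the rotation number of $f$.
   Context: $\mathrm{S}^1=\mathbb{R}/\mathbb{Z}$. A $C^{1+bv}$ diffeomorphism is a $C^1$ diffeomorphism $f$ such that $\log(Df)$ has finite total variation. A map $f$ is $C^1$ rigid if there is an increasing sequence of integers $q_n$ such that $f^{q_n}$ converges to the identity in the $C^1$ topology. The rational approximations of the rotation number are the convergents $p_n/q_n$ of its continued fraction expansion. *)

theory Defs
  imports "HOL-Analysis.Analysis"
begin

section \<open>The circle\<close>

quotient_type circle = real / "\<lambda>x y :: real. x - y \<in> \<int>"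
  morphisms rep_circle to_circle
proof (intro equivpI reflpI sympI transpI)
  fix x y z :: real
  show "x - x \<in> \<int>" by simp
  show "y - x \<in> \<int>" if "x - y \<in> \<int>"
    using Ints_minus[OF that] by simp
  show "x - z \<in> \<int>" if "x - y \<in> \<int>" "y - z \<in> \<int>"
    using Ints_add[OF that] by simp
qed

lemma to_circle_eq_iff: "to_circle x = to_circle y \<longleftrightarrow> x - y \<in> \<int>"
  by (rule circle.abs_eq_iff)

lemma to_circle_surj: "\<exists>t. to_circle t = z"
  by (induction z rule: circle.abs_induct) blast

definition dist_to_int :: "real \<Rightarrow> real" where
  "dist_to_int t = \<bar>t - of_int (round t)\<bar>"

lemma dist_to_int_le: "dist_to_int t \<le> \<bar>t - of_int n\<bar>"
  unfolding dist_to_int_def by (rule round_diff_minimal)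

lemma dist_to_int_shift: "dist_to_int s = dist_to_int t" if "s - t \<in> \<int>"
proof -
  obtain k where k: "s - t = of_int k" using \<open>s - t \<in> \<int>\<close> by (auto elim: Ints_cases)
  have "dist_to_int s \<le> dist_to_int t"
    using dist_to_int_le[of s "round t + k"] k by (simp add: dist_to_int_def algebra_simps)
  moreover have "dist_to_int t \<le> dist_to_int s"
    using dist_to_int_le[of t "round s - k"] k by (simp add: dist_to_int_def algebra_simps)
  ultimately show ?thesis by simp
qed

lemma dist_to_int_minus_le: "dist_to_int (- t) \<le> dist_to_int t"
  using dist_to_int_le[of "- t" "- round t"] by (simp add: dist_to_int_def)

lemma dist_to_int_add_le: "dist_to_int (s + t) \<le> dist_to_int s + dist_to_int t"
  using dist_to_int_le[of "s + t" "round s + round t"] by (simp add: dist_to_int_def)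

lemma dist_to_int_eq_0_iff: "dist_to_int t = 0 \<longleftrightarrow> t \<in> \<int>"
proof
  assume "dist_to_int t = 0"
  then have "t = of_int (round t)" by (simp add: dist_to_int_def)
  then show "t \<in> \<int>" by (metis Ints_of_int)
next
  assume "t \<in> \<int>"
  then show "dist_to_int t = 0" by (auto simp: dist_to_int_def elim: Ints_cases)
qed

instantiation circle :: metric_space
begin

lift_definition dist_circle :: "circle \<Rightarrow> circle \<Rightarrow> real" is "\<lambda>x y. dist_to_int (x - y)"
proof -
  fix a b c d :: real
  assume "a - b \<in> \<int>" "c - d \<in> \<int>"
  then have "(a - c) - (b - d) \<in> \<int>"
    using Ints_diff[of "a - b" "c - d"] by (simp add: algebra_simps)
  then show "dist_to_int (a - c) = dist_to_int (b - d)" by (rule dist_to_int_shift)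
qed

definition uniformity_circle :: "(circle \<times> circle) filter" where
  "uniformity_circle = (INF e\<in>{0<..}. principal {(x, y). dist x y < e})"

definition open_circle :: "circle set \<Rightarrow> bool" where
  "open_circle U \<longleftrightarrow> (\<forall>x\<in>U. eventually (\<lambda>(x', y). x' = x \<longrightarrow> y \<in> U) uniformity)"

instance
proof
  fix x y z :: circle
  show "dist x y = 0 \<longleftrightarrow> x = y"
    by transfer (rule dist_to_int_eq_0_iff)
  show "dist x y \<le> dist x z + dist y z"
  proof transfer
    fix x y z :: real
    have "dist_to_int (x - y) \<le> dist_to_int (x - z) + dist_to_int (- (y - z))"
      using dist_to_int_add_le[of "x - z" "- (y - z)"] by simp
    then show "dist_to_int (x - y) \<le> dist_to_int (x - z) + dist_to_int (y - z)"
      using dist_to_int_minus_le[of "y - z"] by linarith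
  qed
qed (simp_all add: uniformity_circle_def open_circle_def)

end


section \<open>Lifts, derivatives and diffeomorphisms\<close>

definition is_lift :: "(real \<Rightarrow> real) \<Rightarrow> (circle \<Rightarrow> circle) \<Rightarrow> bool" where
  "is_lift F f \<longleftrightarrow> continuous_on UNIV F \<and> (\<forall>t. to_circle (F t) = f (to_circle t))"

definition C1_circle_map :: "(circle \<Rightarrow> circle) \<Rightarrow> bool" where
  "C1_circle_map f \<longleftrightarrow> (\<exists>F. is_lift F f \<and> F C1_differentiable_on UNIV)"

definition C1_circle_diffeo :: "(circle \<Rightarrow> circle) \<Rightarrow> bool" where
  "C1_circle_diffeo f \<longleftrightarrow> bij f \<and> C1_circle_map f \<and> C1_circle_map (inv f)"

definition orientation_preserving :: "(circle \<Rightarrow> circle) \<Rightarrow> bool" where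
  "orientation_preserving f \<longleftrightarrow> (\<exists>F. is_lift F f \<and> strict_mono F)"

text \<open>The value does not depend on the lift or on the representative of the base point:
  see \<open>circle_deriv_eq\<close> below.\<close>

definition circle_deriv :: "(circle \<Rightarrow> circle) \<Rightarrow> circle \<Rightarrow> real" where
  "circle_deriv f z =
     (THE d. \<exists>F t. is_lift F f \<and> to_circle t = z \<and> (F has_real_derivative d) (at t))"

lemma lift_shift_unique:
  assumes F: "is_lift F f" and G: "is_lift G f" and k: "k \<in> \<int>"
  shows "\<exists>c\<in>\<int>. \<forall>t. G (t + k) = F t + c"
proof -
  define h where "h = (\<lambda>t. G (t + k) - F t)"
  have int: "h t \<in> \<int>" for t
  proof -
    have "to_circle (t + k) = to_circle t" using k by (simp add: to_circle_eq_iff)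
    moreover have "to_circle (G (t + k)) = f (to_circle (t + k))" "to_circle (F t) = f (to_circle t)"
      using F G unfolding is_lift_def by blast+
    ultimately have "to_circle (G (t + k)) = to_circle (F t)" by argo
    then show ?thesis by (simp add: to_circle_eq_iff h_def)
  qed
  have contF: "continuous_on UNIV F" and contG: "continuous_on UNIV G"
    using F G by (simp_all add: is_lift_def)
  have "continuous_on UNIV (\<lambda>t. G (t + k))"
    by (rule continuous_on_compose2[OF contG, of UNIV "\<lambda>t. t + k"])
       (simp_all add: continuous_on_add)
  then have cont: "continuous_on UNIV h"
    unfolding h_def using contF by (rule continuous_on_diff)
  have "h constant_on UNIV"
  proof (rule continuous_discrete_range_constant[OF connected_UNIV cont])
    fix x
    show "\<exists>e>0. \<forall>y. y \<in> UNIV \<and> h y \<noteq> h x \<longrightarrow> e \<le> norm (h y - h x)"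
    proof (intro exI[of _ 1] conjI allI impI)
      fix y assume "y \<in> UNIV \<and> h y \<noteq> h x"
      moreover have "h y - h x \<in> \<int>" using int by (intro Ints_diff)
      ultimately show "1 \<le> norm (h y - h x)"
        using Ints_nonzero_abs_ge1[of "h y - h x"] by simp
    qed simp
  qed
  then obtain c where c: "\<And>t. h t = c" by (auto simp: constant_on_def)
  show ?thesis
  proof (intro bexI allI)
    show "c \<in> \<int>" using int[of 0] c[of 0] by simp
    show "G (t + k) = F t + c" for t using c[of t] unfolding h_def by linarith
  qed
qed

lemma circle_deriv_eq:
  assumes F: "is_lift F f" and d: "(F has_real_derivative d) (at t)"
  shows "circle_deriv f (to_circle t) = d"
  unfolding circle_deriv_def
proof (rule the_equality)
  show "\<exists>G s. is_lift G f \<and> to_circle s = to_circle t \<and> (G has_real_derivative d) (at s)"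
    using F d by blast
next
  fix e assume "\<exists>G s. is_lift G f \<and> to_circle s = to_circle t \<and> (G has_real_derivative e) (at s)"
  then obtain G s where G: "is_lift G f" and s: "s - t \<in> \<int>"
    and e: "(G has_real_derivative e) (at s)" by (auto simp: to_circle_eq_iff)
  obtain c where c: "\<And>u. G (u + (s - t)) = F u + c"
    using lift_shift_unique[OF F G s] by blast
  have "((\<lambda>u. G (u + (s - t))) has_real_derivative e) (at t)"
    using e DERIV_shift[of G e t "s - t"] by simp
  moreover have "((\<lambda>u. F u + c) has_real_derivative d) (at t)"
    using d by (auto intro!: derivative_eq_intros)
  ultimately show "e = d" unfolding c by (rule DERIV_unique)
qed


section \<open>Bounded variation and absolute continuity\<close>

definition bounded_variation_on :: "real \<Rightarrow> real \<Rightarrow> (real \<Rightarrow> real) \<Rightarrow> bool" where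
  "bounded_variation_on a b g \<longleftrightarrow>
     (\<exists>B. \<forall>(n::nat) t. mono_on {..n} t \<and> t ` {..n} \<subseteq> {a..b} \<longrightarrow>
        (\<Sum>i<n. \<bar>g (t (Suc i)) - g (t i)\<bar>) \<le> B)"

definition absolutely_continuous_on :: "real \<Rightarrow> real \<Rightarrow> (real \<Rightarrow> real) \<Rightarrow> bool" where
  "absolutely_continuous_on a b g \<longleftrightarrow>
     (\<forall>\<epsilon>>0. \<exists>\<delta>>0. \<forall>(n::nat) u v.
        (\<forall>i<n. a \<le> u i \<and> u i \<le> v i \<and> v i \<le> b) \<and>
        disjoint_family_on (\<lambda>i. {u i<..<v i}) {..<n} \<and>
        (\<Sum>i<n. v i - u i) < \<delta> \<longrightarrow>
        (\<Sum>i<n. \<bar>g (v i) - g (u i)\<bar>) < \<epsilon>)"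

text \<open>On the circle both notions are read on the closed fundamental domain \<open>[0, 1]\<close>, whose two
  endpoints represent the same point.\<close>

definition circle_bounded_variation :: "(circle \<Rightarrow> real) \<Rightarrow> bool" where
  "circle_bounded_variation g \<longleftrightarrow> bounded_variation_on 0 1 (\<lambda>t. g (to_circle t))"

definition circle_absolutely_continuous :: "(circle \<Rightarrow> real) \<Rightarrow> bool" where
  "circle_absolutely_continuous g \<longleftrightarrow> absolutely_continuous_on 0 1 (\<lambda>t. g (to_circle t))"

text \<open>This is meant for orientation-preserving maps, where the derivative is positive.\<close>

definition C1_bv_diffeo :: "(circle \<Rightarrow> circle) \<Rightarrow> bool" where
  "C1_bv_diffeo f \<longleftrightarrow>
     C1_circle_diffeo f \<and> circle_bounded_variation (\<lambda>z. ln (circle_deriv f z))"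


section \<open>Rotation number and continued fractions\<close>

text \<open>The rotation number is an element of \<open>\<real>/\<int>\<close>; it is represented in \<open>[0, 1)\<close>.\<close>

definition rotation_number :: "(circle \<Rightarrow> circle) \<Rightarrow> real" where
  "rotation_number f =
     (THE \<rho>. \<exists>F \<tau>. is_lift F f \<and> (\<forall>t. (\<lambda>n. (F ^^ n) t / real n) \<longlonglongrightarrow> \<tau>) \<and> \<rho> = frac \<tau>)"

text \<open>For irrational \<open>x = [a\<^sub>0; a\<^sub>1, a\<^sub>2, \<dots>]\<close>, \<open>convergent_of x n\<close> is the value of
  \<open>[a\<^sub>0; a\<^sub>1, \<dots>, a\<^sub>n]\<close>.\<close>

fun convergent_of :: "real \<Rightarrow> nat \<Rightarrow> rat" where
  "convergent_of x 0 = of_int \<lfloor>x\<rfloor>"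
| "convergent_of x (Suc n) = of_int \<lfloor>x\<rfloor> + 1 / convergent_of (1 / frac x) n"

definition convergent_denom :: "real \<Rightarrow> nat \<Rightarrow> nat" where
  "convergent_denom x n = nat (snd (quotient_of (convergent_of x n)))"


section \<open>Convergence in the C1 topology\<close>

definition C1_tendsto :: "(nat \<Rightarrow> circle \<Rightarrow> circle) \<Rightarrow> (circle \<Rightarrow> circle) \<Rightarrow> bool" where
  "C1_tendsto g h \<longleftrightarrow>
     uniform_limit UNIV g h sequentially \<and>
     uniform_limit UNIV (\<lambda>n. circle_deriv (g n)) (circle_deriv h) sequentially"

definition C1_rigid :: "(circle \<Rightarrow> circle) \<Rightarrow> bool" where
  "C1_rigid f \<longleftrightarrow> (\<exists>q :: nat \<Rightarrow> nat. strict_mono q \<and> C1_tendsto (\<lambda>n. f ^^ q n) id)"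

end

theory Submission
  imports Defs
begin

text \<open>Let \<open>F\<close> be a lift of \<open>f\<close> and \<open>g = ln F'\<close>, so that \<open>ln (F ^^ q)'\<close> is the Birkhoff sum \<open>S q g\<close> of \<open>g\<close>. For a
  denominator \<open>q\<close> of a convergent, the Denjoy-Koksma inequality bounds the oscillation of \<open>S q r\<close> by
  a multiple of the variation of \<open>r\<close>, and \<open>S q g\<close> has a zero. It therefore suffices to
  write \<open>g\<close>, up to a continuous coboundary \<open>\<psi> - \<psi> \<circ> F\<close>, as a function of arbitrarily small variation: the
  Birkhoff sums of the coboundary are small because \<open>F ^^ q - p\<close> converges uniformly to the identity.

  The average \<open>S q r / q\<close> differs from \<open>r\<close> by a coboundary, and for large \<open>q\<close> it has smaller variation
  by a factor that depends only on the variation of \<open>g\<close>. Indeed, an absolutely continuous \<open>r\<close> is close in variation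
  to a piecewise linear function, hence to a combination, with coefficients of sum zero, of primitives of indicator
  functions of arcs. By bounded distortion, the iterates of a short interval visit every arc in a proportion
  comparable to the length of the arc, so that positive and negative slopes partially cancel.\<close>

section \<open>Convergents\<close>

text \<open>The Denjoy-Koksma bound does not improve as \<open>q\<close> grows: applied to
  \<open>g\<close> itself it yields only boundedness of \<open>S q g\<close>. What can improve is
  the representative of \<open>g\<close> modulo coboundaries. The factor gained by one averaging
  comes from the distortion of \<open>F\<close>, hence from the variation of \<open>g\<close> and
  not from the function being averaged; therefore the averaging can be repeated with the same
  factor. A singular part would stay at a fixed distance, in variation, from all piecewise linear
  functions; and it is the finite number of arcs that lets one \<open>q\<close> serve all of them.
  The coboundary is fixed before the limit along the denominators is taken. Neither an invariant
  measure nor almost everywhere derivatives occur: comparing two orbits replaces comparing an orbit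
  with the mean, and the length of polygonal graphs replaces the approximation of an integrable
  derivative by step functions.\<close>

lemma irrational_gauss_map:
  assumes "x \<notin> \<rat>"
  shows "frac x > 0" "1 / frac x \<notin> \<rat>" "1 / frac x > 1"
proof -
  have "frac x \<noteq> 0"
    using assms by (auto simp: frac_eq_0_iff elim: Ints_cases)
  then show pos: "frac x > 0" by (simp add: order_less_le)
  show "1 / frac x \<notin> \<rat>"
  proof
    assume "1 / frac x \<in> \<rat>"
    then have "inverse (1 / frac x) \<in> \<rat>" by (rule Rats_inverse)
    then have "inverse (1 / frac x) + of_int \<lfloor>x\<rfloor> \<in> \<rat>" by (rule Rats_add) simp
    moreover have "inverse (1 / frac x) + of_int \<lfloor>x\<rfloor> = x" by (simp add: frac_def)
    ultimately show False using assms by simp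
  qed
  show "1 / frac x > 1" using pos frac_lt_1[of x] by (simp add: field_simps)
qed

text \<open>The recursion adds a partial quotient in front, as \<open>convergent_of\<close> does,
  and not at the end: \<open>P / Q\<close> becomes \<open>\<lfloor>x\<rfloor> + Q / P\<close>, so
  the new denominator is the numerator of the tail.\<close>

fun convergent_num :: "real \<Rightarrow> nat \<Rightarrow> int" and convergent_den :: "real \<Rightarrow> nat \<Rightarrow> int" where
  "convergent_num x 0 = \<lfloor>x\<rfloor>"
| "convergent_den x 0 = 1"
| "convergent_num x (Suc n) = \<lfloor>x\<rfloor> * convergent_num (1 / frac x) n + convergent_den (1 / frac x) n"
| "convergent_den x (Suc n) = convergent_num (1 / frac x) n"

text \<open>Denominators of \<open>x\<close> are numerators of its tail, so both signs go through
  one induction; the tail always exceeds 1, as the claim on numerators demands.\<close>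

lemma convergent_num_den_pos:
  assumes "x \<notin> \<rat>"
  shows "convergent_den x n \<ge> 1 \<and> (1 < x \<longrightarrow> convergent_num x n \<ge> 1)"
  using assms
proof (induction n arbitrary: x)
  case 0
  then show ?case by (auto simp: le_floor_iff)
next
  case (Suc n)
  note irr = irrational_gauss_map[OF Suc.prems]
  have ih: "convergent_den (1 / frac x) n \<ge> 1" "convergent_num (1 / frac x) n \<ge> 1"
    using Suc.IH[OF irr(2)] irr(3) by auto
  have "1 \<le> \<lfloor>x\<rfloor> * convergent_num (1 / frac x) n + convergent_den (1 / frac x) n" if "1 < x"
  proof -
    have "0 \<le> \<lfloor>x\<rfloor> * convergent_num (1 / frac x) n"
      using that ih by (intro mult_nonneg_nonneg) auto
    then show ?thesis using ih by linarith
  qed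
  then show ?case using ih by simp
qed

lemma convergent_den_pos: "x \<notin> \<rat> \<Longrightarrow> convergent_den x n \<ge> 1"
  using convergent_num_den_pos by blast

lemma coprime_convergent: "coprime (convergent_num x n) (convergent_den x n)"
proof (induction n arbitrary: x)
  case (Suc n)
  let ?P = "convergent_num (1 / frac x) n" and ?Q = "convergent_den (1 / frac x) n"
  have "gcd ?P (\<lfloor>x\<rfloor> * ?P + ?Q) = gcd ?P ?Q" by (rule gcd_add_mult)
  then show ?case using Suc[of "1 / frac x"]
    by (simp add: coprime_iff_gcd_eq_1 gcd.commute)
qed simp

lemma convergent_of_eq:
  assumes "x \<notin> \<rat>"
  shows "convergent_of x n = of_int (convergent_num x n) / of_int (convergent_den x n)"
  using assms
proof (induction n arbitrary: x)
  case (Suc n)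
  note irr = irrational_gauss_map[OF Suc.prems]
  have "convergent_num (1 / frac x) n \<ge> 1"
    using convergent_num_den_pos[OF irr(2)] irr(3) by auto
  then show ?case using Suc.IH[OF irr(2)] by (simp add: add_divide_distrib)
qed simp

lemma convergent_denom_eq:
  assumes "x \<notin> \<rat>"
  shows "convergent_denom x n = nat (convergent_den x n)"
proof -
  have "quotient_of (convergent_of x n) = (convergent_num x n, convergent_den x n)"
    using convergent_den_pos[OF assms, of n] coprime_convergent[of x n]
    by (simp add: convergent_of_eq[OF assms] quotient_of_Fract flip: Fract_of_int_quotient)
  then show ?thesis by (simp add: convergent_denom_def)
qed

text \<open>A partial quotient put in front acts on the pairs of numerator and denominator by a
  matrix of determinant -1.\<close>

lemma convergent_det:
  "convergent_num x (Suc n) * convergent_den x n - convergent_num x n * convergent_den x (Suc n)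
     = (- 1) ^ n"
proof (induction n arbitrary: x)
  case (Suc n)
  show ?case using Suc[of "1 / frac x"] by (simp add: algebra_simps)
qed simp

text \<open>With \<open>y = 1 / frac x\<close>, the error of \<open>x\<close> at
  \<open>n + 1\<close> is \<open>- frac x\<close> times the error of \<open>y\<close> at
  \<open>n\<close>.\<close>

lemma convergent_error_sign:
  assumes "x \<notin> \<rat>"
  shows "(- 1) ^ n * (of_int (convergent_den x n) * x - of_int (convergent_num x n)) > 0"
  using assms
proof (induction n arbitrary: x)
  case 0
  then show ?case using irrational_gauss_map(1)[OF 0] by (simp add: frac_def)
next
  case (Suc n)
  note irr = irrational_gauss_map[OF Suc.prems]
  let ?P = "of_int (convergent_num (1 / frac x) n) :: real"
  let ?Q = "of_int (convergent_den (1 / frac x) n) :: real"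
  have "0 < frac x * ((- 1) ^ n * (?Q * (1 / frac x) - ?P))"
    by (rule mult_pos_pos[OF irr(1) Suc.IH[OF irr(2)]])
  also have "\<dots> = (- 1) ^ n * (?Q - ?P * frac x)" using irr(1) by (simp add: algebra_simps)
  also have "\<dots> = (- 1) ^ Suc n * (?P * x - (of_int \<lfloor>x\<rfloor> * ?P + ?Q))"
    by (simp add: frac_def algebra_simps)
  finally show ?case by simp
qed

text \<open>Unfolding the recursion twice expresses the denominators of \<open>x\<close> through
  those of the tail and of the tail of the tail, hence the strong induction. Strictness starts at 1
  because the first two denominators can both be 1.\<close>

lemma convergent_den_mono:
  assumes "x \<notin> \<rat>"
  shows "convergent_den x n \<le> convergent_den x (Suc n)"
    and "n \<ge> 1 \<Longrightarrow> convergent_den x n < convergent_den x (Suc n)"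
proof -
  have "convergent_den x n \<le> convergent_den x (Suc n) \<and>
      (n \<ge> 1 \<longrightarrow> convergent_den x n < convergent_den x (Suc n))"
    using assms
  proof (induction n arbitrary: x rule: less_induct)
    case (less n)
    note irr = irrational_gauss_map[OF less.prems]
    define y where "y = 1 / frac x"
    have y: "y \<notin> \<rat>" "y > 1" using irr by (auto simp: y_def)
    have fl: "\<lfloor>y\<rfloor> \<ge> 1" using y(2) by (simp add: le_floor_iff)
    consider "n = 0" | "n = 1" | m where "n = Suc (Suc m)" by (metis One_nat_def not0_implies_Suc)
    then show ?case
    proof cases
      case 1
      then show ?thesis using convergent_num_den_pos[OF y(1), of 0] y(2) by (simp flip: y_def)
    next
      case 2
      have "\<lfloor>y\<rfloor> * 1 \<le> \<lfloor>y\<rfloor> * \<lfloor>1 / frac y\<rfloor>"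
        using fl irrational_gauss_map(3)[OF y(1)] by (intro mult_left_mono) (auto simp: le_floor_iff)
      then show ?thesis using 2 by (simp flip: y_def)
    next
      case 3
      define z where "z = 1 / frac y"
      have z: "z \<notin> \<rat>" using irrational_gauss_map[OF y(1)] by (auto simp: z_def)
      have "convergent_den y (Suc m) < convergent_den y (Suc (Suc m))"
        using less.IH[of "Suc m" y] 3 y by auto
      then have "\<lfloor>y\<rfloor> * convergent_den y (Suc m) < \<lfloor>y\<rfloor> * convergent_den y (Suc (Suc m))"
        using fl by (intro mult_strict_left_mono) auto
      moreover have "convergent_den z m \<le> convergent_den z (Suc m)"
        using less.IH[of m z] 3 z by auto
      ultimately show ?thesis using 3 by (simp flip: y_def z_def)
    qed
  qed
  then show "convergent_den x n \<le> convergent_den x (Suc n)"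
    "n \<ge> 1 \<Longrightarrow> convergent_den x n < convergent_den x (Suc n)" by auto
qed

text \<open>Consecutive errors \<open>e\<close>, \<open>e'\<close> have opposite signs, so the
  determinant identity reads \<open>q' * \<bar>e\<bar> + q * \<bar>e'\<bar> = 1\<close> with
  positive terms, and \<open>q \<le> q'\<close>.\<close>

lemma convergent_error:
  assumes "x \<notin> \<rat>"
  shows "\<bar>of_int (convergent_den x n) * x - of_int (convergent_num x n)\<bar> * of_int (convergent_den x n) < 1"
proof -
  define e where "e k = of_int (convergent_den x k) * x - of_int (convergent_num x k)" for k
  define D where "D k = (of_int (convergent_den x k) :: real)" for k
  have sign: "(- 1) ^ k * e k > 0" for k using convergent_error_sign[OF assms] by (simp add: e_def)
  have abs: "\<bar>e k\<bar> = (- 1) ^ k * e k" for k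
    using sign[of k] by (cases "even k") auto
  have D: "D k \<ge> 1" "D k \<le> D (Suc k)" for k
    using convergent_den_pos[OF assms, of k] convergent_den_mono(1)[OF assms, of k]
    by (auto simp: D_def)
  have "D (Suc n) * e n - D n * e (Suc n)
     = of_int (convergent_num x (Suc n) * convergent_den x n - convergent_num x n * convergent_den x (Suc n))"
    unfolding D_def e_def of_int_diff of_int_mult by algebra
  also have "\<dots> = (- 1) ^ n" unfolding convergent_det by simp
  finally have "(- 1) ^ n * (D (Suc n) * e n - D n * e (Suc n)) = 1"
    by (simp flip: power_mult_distrib)
  then have "D (Suc n) * \<bar>e n\<bar> + D n * \<bar>e (Suc n)\<bar> = 1"
    unfolding abs by (simp add: algebra_simps)
  moreover have "D n * \<bar>e (Suc n)\<bar> > 0"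
    using D[of n] sign[of "Suc n"] abs[of "Suc n"] by (intro mult_pos_pos) auto
  moreover have "D n * \<bar>e n\<bar> \<le> D (Suc n) * \<bar>e n\<bar>" using D by (intro mult_right_mono) auto
  ultimately have "\<bar>e n\<bar> * D n < 1" by (simp add: mult.commute)
  then show ?thesis by (simp add: e_def D_def)
qed

text \<open>The arithmetic behind the estimates for a single \<open>q\<close>: the error bound keeps
  \<open>i * \<alpha>\<close> within \<open>1 / q\<close> of \<open>i * p / q\<close> for all
  \<open>i < q\<close>.\<close>

definition good_approx :: "real \<Rightarrow> int \<Rightarrow> nat \<Rightarrow> bool" where
  "good_approx \<alpha> p q \<longleftrightarrow> q > 0 \<and> coprime p (int q) \<and> \<bar>real q * \<alpha> - of_int p\<bar> < 1 / real q"

lemma convergent_good_approx: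
  assumes "x \<notin> \<rat>"
  shows "good_approx x (convergent_num x n) (convergent_denom x n)"
proof -
  have pos: "convergent_den x n \<ge> 1" by (rule convergent_den_pos[OF assms])
  then have "real (nat (convergent_den x n)) = of_int (convergent_den x n)" by simp
  then show ?thesis
    using pos coprime_convergent[of x n] convergent_error[OF assms, of n]
    by (auto simp: good_approx_def convergent_denom_eq[OF assms] field_simps)
qed

lemma strict_mono_convergent_denom:
  assumes "x \<notin> \<rat>"
  shows "strict_mono (\<lambda>n. convergent_denom x (Suc n))"
proof (rule strict_monoI_Suc)
  fix n
  show "convergent_denom x (Suc n) < convergent_denom x (Suc (Suc n))"
    using convergent_den_mono(2)[OF assms, of "Suc n"] convergent_den_pos[OF assms, of "Suc n"]
    unfolding convergent_denom_eq[OF assms] by linarith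
qed

section \<open>Functions of bounded variation on the circle\<close>

lemma degree_shift_int:
  fixes v :: "real \<Rightarrow> real"
  assumes "\<And>t. v (t + 1) = v t + w"
  shows "v (t + of_int k) = v t + of_int k * w"
proof (induction k rule: int_induct[where k = 0])
  case (step1 i)
  then show ?case using assms[of "t + of_int i"] by (simp add: algebra_simps)
next
  case (step2 i)
  then show ?case using assms[of "t + of_int (i - 1)"] by (simp add: algebra_simps)
qed simp

lemma periodic_shift_int:
  fixes r :: "real \<Rightarrow> real"
  assumes "\<And>t. r (t + 1) = r t"
  shows "r (t + of_int k) = r t"
  using degree_shift_int[of r 0] assms by simp

text \<open>The variation over a period is at most \<open>w\<close>, witnessed by a degree \<open>w\<close> monotone function; unlike a
  supremum over partitions of \<open>[0, 1]\<close>, this form is visibly stable under composition with lifts.\<close>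

definition variation_le :: "(real \<Rightarrow> real) \<Rightarrow> real \<Rightarrow> bool" where
  "variation_le r w \<longleftrightarrow>
     (\<exists>v. mono v \<and> (\<forall>t. v (t + 1) = v t + w) \<and> (\<forall>s t. s \<le> t \<longrightarrow> \<bar>r t - r s\<bar> \<le> v t - v s))"

lemma variation_leI:
  assumes "\<And>t. v (t + 1) = v t + w" "\<And>s t. s \<le> t \<Longrightarrow> \<bar>r t - r s\<bar> \<le> v t - v s"
  shows "variation_le r w"
  unfolding variation_le_def
proof (intro exI[of _ v] conjI monoI)
  fix s t :: real assume "s \<le> t"
  then show "v s \<le> v t" using assms(2)[of s t] by linarith
qed (use assms in auto)

lemma variation_leE:
  assumes "variation_le r w"
  obtains v where "mono v" "\<And>t. v (t + 1) = v t + w"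
    "\<And>s t. s \<le> t \<Longrightarrow> \<bar>r t - r s\<bar> \<le> v t - v s"
  using assms unfolding variation_le_def by blast

lemma variation_le_nonneg: "variation_le r w \<Longrightarrow> 0 \<le> w"
proof (erule variation_leE)
  fix v :: "real \<Rightarrow> real" assume "mono v" "\<And>t. v (t + 1) = v t + w"
  then have "v 0 \<le> v 0 + w" using monoD[of v 0 1] by (metis add_0 zero_le_one)
  then show "0 \<le> w" by simp
qed

lemma variation_le_mono:
  assumes "variation_le r w" "w \<le> w'"
  shows "variation_le r w'"
proof -
  obtain v where v: "\<And>t. v (t + 1) = v t + w"
    "\<And>s t. s \<le> t \<Longrightarrow> \<bar>r t - r s\<bar> \<le> v t - v s"
    by (rule variation_leE[OF assms(1)]) blast
  show ?thesis
  \<comment> \<open>The degree of the majorant must be exactly \<open>w'\<close>; a linear term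
    takes up the excess.\<close>
  proof (rule variation_leI[where v = "\<lambda>t. v t + (w' - w) * t"])
    fix s t :: real assume "s \<le> t"
    then have "\<bar>r t - r s\<bar> \<le> v t - v s" "(w' - w) * s \<le> (w' - w) * t"
      using v(2) assms(2) by (auto intro: mult_left_mono)
    then show "\<bar>r t - r s\<bar> \<le> v t + (w' - w) * t - (v s + (w' - w) * s)" by linarith
  qed (simp add: v algebra_simps)
qed

lemma variation_le_add:
  assumes "variation_le r w" "variation_le r' w'"
  shows "variation_le (\<lambda>t. r t + r' t) (w + w')"
proof -
  obtain v where v: "\<And>t. v (t + 1) = v t + w"
    "\<And>s t. s \<le> t \<Longrightarrow> \<bar>r t - r s\<bar> \<le> v t - v s"
    by (rule variation_leE[OF assms(1)]) blast
  obtain v' where v': "\<And>t. v' (t + 1) = v' t + w'"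
    "\<And>s t. s \<le> t \<Longrightarrow> \<bar>r' t - r' s\<bar> \<le> v' t - v' s"
    by (rule variation_leE[OF assms(2)]) blast
  show ?thesis
  proof (rule variation_leI[where v = "\<lambda>t. v t + v' t"])
    fix s t :: real assume "s \<le> t"
    then show "\<bar>r t + r' t - (r s + r' s)\<bar> \<le> v t + v' t - (v s + v' s)"
      using v(2)[of s t] v'(2)[of s t] by linarith
  qed (simp add: v v')
qed

lemma variation_le_cmult:
  assumes "variation_le r w"
  shows "variation_le (\<lambda>t. c * r t) (\<bar>c\<bar> * w)"
proof -
  obtain v where v: "\<And>t. v (t + 1) = v t + w"
    "\<And>s t. s \<le> t \<Longrightarrow> \<bar>r t - r s\<bar> \<le> v t - v s"
    by (rule variation_leE[OF assms(1)]) blast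
  show ?thesis
  proof (rule variation_leI[where v = "\<lambda>t. \<bar>c\<bar> * v t"])
    fix s t :: real assume "s \<le> t"
    then have "\<bar>c\<bar> * \<bar>r t - r s\<bar> \<le> \<bar>c\<bar> * (v t - v s)" by (intro mult_left_mono v(2)) auto
    then show "\<bar>c * r t - c * r s\<bar> \<le> \<bar>c\<bar> * v t - \<bar>c\<bar> * v s"
      by (simp add: right_diff_distrib flip: abs_mult)
  qed (simp add: v algebra_simps)
qed

lemma variation_le_zero: "variation_le (\<lambda>t. 0) 0"
  by (rule variation_leI[where v = "\<lambda>t. 0"]) auto

lemma variation_le_sum:
  assumes "finite A" "\<And>i. i \<in> A \<Longrightarrow> variation_le (r i) (w i)"
  shows "variation_le (\<lambda>t. \<Sum>i\<in>A. r i t) (\<Sum>i\<in>A. w i)"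
  using assms by (induction A rule: finite_induct) (auto intro: variation_le_zero variation_le_add)

lemma variation_le_compose:
  assumes "variation_le r w" "mono h" "\<And>t. h (t + 1) = h t + 1"
  shows "variation_le (\<lambda>t. r (h t)) w"
proof -
  obtain v where v: "\<And>t. v (t + 1) = v t + w"
    "\<And>s t. s \<le> t \<Longrightarrow> \<bar>r t - r s\<bar> \<le> v t - v s"
    by (rule variation_leE[OF assms(1)]) blast
  show ?thesis
    by (rule variation_leI[where v = "\<lambda>t. v (h t)"]) (use v assms(2,3) in \<open>auto dest: monoD\<close>)
qed

text \<open>The majorant is the total variation of \<open>r\<close> over \<open>[0, x]\<close>,
  continued to the line so that it grows by \<open>V 1\<close> per period.\<close>

lemma variation_le_of_partitions:
  fixes r :: "real \<Rightarrow> real"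
  assumes per: "\<And>t. r (t + 1) = r t"
    and B: "\<And>n t. mono_on {..n::nat} t \<Longrightarrow> t ` {..n} \<subseteq> {0..1} \<Longrightarrow>
      (\<Sum>i<n. \<bar>r (t (Suc i)) - r (t i)\<bar>) \<le> B"
  shows "variation_le r B"
proof -
  define S where "S x = {(\<Sum>i<n. \<bar>r (t (Suc i)) - r (t i)\<bar>) | n t.
    mono_on {..n::nat} t \<and> t ` {..n} \<subseteq> {0..x}}" for x :: real
  define V where "V x = Sup (S x)" for x
  have bound: "e \<le> B" if "e \<in> S x" "x \<le> 1" for e x
    using that B by (fastforce simp: S_def)
  have bdd: "bdd_above (S x)" if "x \<le> 1" for x
    using bound that by (intro bdd_aboveI[of _ B]) auto
  have ne: "S x \<noteq> {}" if "x \<ge> 0" for x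
  proof -
    have "(\<Sum>i<(0::nat). \<bar>r ((\<lambda>_. 0) (Suc i)) - r ((\<lambda>_. 0) i)\<bar>) \<in> S x"
      using that unfolding S_def by (intro CollectI exI conjI) (auto simp: mono_on_def)
    then show ?thesis by blast
  qed
  have V1: "V 1 \<le> B" unfolding V_def using ne[of 1] bound by (intro cSup_least) auto
  have ext: "V s + \<bar>r t - r s\<bar> \<le> V t" if st: "0 \<le> s" "s \<le> t" "t \<le> 1" for s t
  proof -
    have "e \<le> V t - \<bar>r t - r s\<bar>" if eS: "e \<in> S s" for e
    proof -
      obtain n u where e: "e = (\<Sum>i<n. \<bar>r (u (Suc i)) - r (u i)\<bar>)"
        and u: "mono_on {..n} u" "u ` {..n} \<subseteq> {0..s}"
        using eS unfolding S_def by blast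
      \<comment> \<open>Prolonging a partition of \<open>[0, s]\<close> by the points
        \<open>s\<close> and \<open>t\<close> adds the increment of \<open>r\<close> from
        \<open>s\<close> to \<open>t\<close> to its sum.\<close>
      define u' where "u' i = (if i \<le> n then u i else if i = Suc n then s else t)" for i
      have "u i \<le> s" "0 \<le> u i" if "i \<le> n" for i using u(2) that by auto
      then have "mono_on {..Suc (Suc n)} u'" "u' ` {..Suc (Suc n)} \<subseteq> {0..t}"
        using u(1) st by (fastforce simp: mono_on_def u'_def)+
      then have "(\<Sum>i<Suc (Suc n). \<bar>r (u' (Suc i)) - r (u' i)\<bar>) \<in> S t"
        unfolding S_def by blast
      then have "(\<Sum>i<Suc (Suc n). \<bar>r (u' (Suc i)) - r (u' i)\<bar>) \<le> V t"
        unfolding V_def by (intro cSup_upper bdd st)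
      moreover have "(\<Sum>i<n. \<bar>r (u' (Suc i)) - r (u' i)\<bar>) = e"
        unfolding e by (intro sum.cong) (auto simp: u'_def)
      ultimately have "e + \<bar>r s - r (u n)\<bar> + \<bar>r t - r s\<bar> \<le> V t" by (simp add: u'_def)
      then show ?thesis by linarith
    qed
    then have "V s \<le> V t - \<bar>r t - r s\<bar>" unfolding V_def using ne st by (intro cSup_least) auto
    then show ?thesis by simp
  qed
  define v where "v x = V (frac x) + of_int \<lfloor>x\<rfloor> * V 1" for x
  have V0: "V 0 \<le> V x" if "0 \<le> x" "x \<le> 1" for x using ext[of 0 x] that by linarith
  have V00: "V 0 = 0"
  proof -
    have "e = 0" if eS: "e \<in> S 0" for e
    proof -
      obtain n u where e: "e = (\<Sum>i<n. \<bar>r (u (Suc i)) - r (u i)\<bar>)"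
        and u: "u ` {..n} \<subseteq> {0..0}"
        using eS unfolding S_def by blast
      have "u i = 0" if "i \<le> n" for i using u that by fastforce
      then show ?thesis unfolding e by (intro sum.neutral) auto
    qed
    then have "S 0 = {0}" using ne[of 0] by auto
    then show ?thesis by (simp add: V_def)
  qed
  have rfrac: "r x = r (frac x)" for x
    using periodic_shift_int[of r "frac x" "\<lfloor>x\<rfloor>"] per by (simp add: frac_def)
  have fr: "0 \<le> frac x" "frac x \<le> 1" for x :: real using frac_lt_1[of x] by (auto intro: less_imp_le)
  have "variation_le r (V 1)"
  proof (rule variation_leI[where v = v])
    fix s t :: real assume "s \<le> t"
    then have fl: "\<lfloor>s\<rfloor> \<le> \<lfloor>t\<rfloor>" by (rule floor_mono)
    show "\<bar>r t - r s\<bar> \<le> v t - v s"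
    proof (cases "\<lfloor>s\<rfloor> = \<lfloor>t\<rfloor>")
      case True
      then have "frac s \<le> frac t" using \<open>s \<le> t\<close> by (simp add: frac_def)
      then show ?thesis
        using ext[of "frac s" "frac t"] fr True rfrac[of s] rfrac[of t] by (simp add: v_def)
    next
      case False
      \<comment> \<open>An integer separates \<open>s\<close> from \<open>t\<close>: pass from
        \<open>frac s\<close> up to 1 and from 0 up to \<open>frac t\<close>, with
        \<open>r 1 = r 0\<close>; further full turns only increase the majorant.\<close>
      then have "1 \<le> \<lfloor>t\<rfloor> - \<lfloor>s\<rfloor>" using fl by linarith
      then have "(1::real) \<le> of_int (\<lfloor>t\<rfloor> - \<lfloor>s\<rfloor>)" by linarith
      moreover have "0 \<le> V 1" using V0[of 1] V00 by simp
      ultimately have "V 1 \<le> of_int (\<lfloor>t\<rfloor> - \<lfloor>s\<rfloor>) * V 1"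
        using mult_right_mono[of 1 "of_int (\<lfloor>t\<rfloor> - \<lfloor>s\<rfloor>)" "V 1"] by simp
      moreover have "\<bar>r (frac t) - r 0\<bar> \<le> V (frac t)" using ext[of 0 "frac t"] fr V00 by simp
      moreover have "V (frac s) + \<bar>r 1 - r (frac s)\<bar> \<le> V 1" using ext[of "frac s" 1] fr by simp
      moreover have "r 1 = r 0" using per[of 0] by simp
      ultimately show ?thesis using rfrac[of s] rfrac[of t] by (simp add: v_def algebra_simps)
    qed
  qed (simp add: v_def frac_def algebra_simps)
  then show ?thesis using V1 by (rule variation_le_mono)
qed

section \<open>Piecewise linear interpolation\<close>

text \<open>For \<open>0 \<le> a \<le> b \<le> 1\<close>, the primitive of the indicator function of
  the arc \<open>[a, b]\<close> modulo 1 that vanishes at 0.\<close>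

definition arc_length :: "real \<Rightarrow> real \<Rightarrow> real \<Rightarrow> real" where
  "arc_length a b t = of_int \<lfloor>t\<rfloor> * (b - a) + (max a (min b (frac t)) - a)"

text \<open>Valid up to the right end point, where the floor has already jumped, so that closed unit
  intervals need no case distinction later.\<close>

lemma arc_length_on:
  assumes "0 \<le> a" "a \<le> b" "b \<le> 1" "of_int n \<le> t" "t \<le> of_int n + 1"
  shows "arc_length a b t = of_int n * (b - a) + (max a (min b (t - of_int n)) - a)"
proof (cases "t = of_int n + 1")
  case True
  then have "\<lfloor>t\<rfloor> = n + 1" "frac t = 0" by (simp_all add: frac_def)
  then show ?thesis using True assms by (simp add: arc_length_def algebra_simps)
next
  case False
  then have "\<lfloor>t\<rfloor> = n" using assms by (simp add: floor_eq_iff)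
  then show ?thesis by (simp add: arc_length_def frac_def)
qed

lemma arc_length_shift:
  "arc_length a b (t + 1) = arc_length a b t + (b - a)"
  by (simp add: arc_length_def frac_def algebra_simps)

lemma arc_length_diff_cell:
  assumes "0 \<le> a" "a \<le> b" "b \<le> 1" "of_int n + a \<le> s" "s \<le> t" "t \<le> of_int n + b"
  shows "arc_length a b t - arc_length a b s = t - s"
proof -
  have "of_int n \<le> s" "s \<le> of_int n + 1" "of_int n \<le> t" "t \<le> of_int n + 1"
    using assms by linarith+
  then show ?thesis using assms
    by (subst (1 2) arc_length_on[where n = n]) auto
qed

lemma mono_arc_length:
  assumes "0 \<le> a" "a \<le> b" "b \<le> 1"
  shows "mono (arc_length a b)"
proof (rule monoI)
  fix s t :: real assume "s \<le> t"
  show "arc_length a b s \<le> arc_length a b t"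
  proof (cases "\<lfloor>s\<rfloor> = \<lfloor>t\<rfloor>")
    case True
    then have "frac s \<le> frac t" using \<open>s \<le> t\<close> by (simp add: frac_def)
    then show ?thesis using True by (auto simp: arc_length_def)
  next
    case False
    then have "1 \<le> \<lfloor>t\<rfloor> - \<lfloor>s\<rfloor>" using floor_mono[OF \<open>s \<le> t\<close>] by linarith
    then have "(1::real) \<le> of_int (\<lfloor>t\<rfloor> - \<lfloor>s\<rfloor>)" by linarith
    then have "1 * (b - a) \<le> of_int (\<lfloor>t\<rfloor> - \<lfloor>s\<rfloor>) * (b - a)"
      using assms by (intro mult_right_mono) auto
    moreover have "max a (min b (frac s)) - a \<le> b - a" "0 \<le> max a (min b (frac t)) - a"
      using assms by auto
    ultimately show ?thesis by (simp add: arc_length_def algebra_simps)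
  qed
qed

lemma continuous_arc_length:
  assumes "0 \<le> a" "a \<le> b" "b \<le> 1"
  shows "continuous_on {0..1} (arc_length a b)"
proof -
  have "continuous_on {0..1} (\<lambda>t. max a (min b t) - a)"
    by (intro continuous_intros)
  then show ?thesis
    by (rule continuous_on_eq) (use arc_length_on[OF assms, of 0] in auto)
qed

text \<open>The piecewise linear interpolation of \<open>g - g 0\<close> at the multiples of
  \<open>1 / M\<close>. As a combination of primitives of indicators it exposes the slopes, whose
  cancellation drives the contraction.\<close>

definition interpolant :: "(real \<Rightarrow> real) \<Rightarrow> nat \<Rightarrow> real \<Rightarrow> real" where
  "interpolant g M t = (\<Sum>l<M. real M * (g ((real l + 1) / M) - g (real l / M)) *
     arc_length (real l / M) ((real l + 1) / M) t)"

lemma sum_grid_increments: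
  fixes g :: "real \<Rightarrow> real"
  assumes "M > 0"
  shows "(\<Sum>l<M. g ((real l + 1) / M) - g (real l / M)) = g 1 - g 0"
  using sum_lessThan_telescope[of "\<lambda>l. g (real l / M)" M] assms by (simp add: add.commute)

lemma sum_abs_grid_increments:
  assumes "variation_le g w" "M > 0"
  shows "(\<Sum>l<M. \<bar>g ((real l + 1) / M) - g (real l / M)\<bar>) \<le> w"
proof -
  obtain v where v: "\<And>t. v (t + 1) = v t + w"
    "\<And>s t. s \<le> t \<Longrightarrow> \<bar>g t - g s\<bar> \<le> v t - v s"
    by (rule variation_leE[OF assms(1)]) blast
  have "(\<Sum>l<M. \<bar>g ((real l + 1) / M) - g (real l / M)\<bar>)
      \<le> (\<Sum>l<M. v ((real l + 1) / M) - v (real l / M))"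
    by (intro sum_mono v(2) divide_right_mono) auto
  also have "\<dots> = w" using sum_grid_increments[OF assms(2), of v] v(1)[of 0] by simp
  finally show ?thesis .
qed

lemma interpolant_shift:
  assumes "g 1 = g 0" "M > 0"
  shows "interpolant g M (t + 1) = interpolant g M t"
proof -
  have "interpolant g M (t + 1) - interpolant g M t =
     (\<Sum>l<M. g ((real l + 1) / M) - g (real l / M))"
    unfolding interpolant_def arc_length_shift sum_subtractf[symmetric]
    using assms(2) by (intro sum.cong) (auto simp: field_simps)
  then show ?thesis using sum_grid_increments[OF assms(2), of g] assms(1) by simp
qed

lemma interpolant_diff_cell:
  assumes l: "l < M" and st: "real l / M \<le> s" "s \<le> t" "t \<le> (real l + 1) / M"
  shows "interpolant g M t - interpolant g M s
    = real M * (g ((real l + 1) / M) - g (real l / M)) * (t - s)"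
proof -
  define m where "m k = real M * (g ((real k + 1) / M) - g (real k / M))" for k
  have "M > 0" using l by simp
  have st01: "0 \<le> s" "s \<le> 1" "0 \<le> t" "t \<le> 1"
    using st l order_trans[of 0 "real l / M" s] order_trans[of t "(real l + 1) / M" 1]
    by (auto simp: field_simps)
  have inc: "arc_length (real k / M) ((real k + 1) / M) t - arc_length (real k / M) ((real k + 1) / M) s
      = (if k = l then t - s else 0)" if k: "k < M" for k
  proof -
    have ab: "0 \<le> real k / M" "real k / M \<le> (real k + 1) / M" "(real k + 1) / M \<le> 1"
      using k by (auto simp: field_simps)
    have eq: "arc_length (real k / M) ((real k + 1) / M) x =
        max (real k / M) (min ((real k + 1) / M) x) - real k / M" if "0 \<le> x" "x \<le> 1" for x
      using arc_length_on[OF ab, of 0 x] that by simp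
    consider "k = l" | "k < l" | "l < k" by linarith
    then show ?thesis
    proof cases
      case 1
      then show ?thesis unfolding eq[OF st01(1,2)] eq[OF st01(3,4)] using st by auto
    next
      case 2
      then have "(real k + 1) / M \<le> real l / M" by (intro divide_right_mono) auto
      then show ?thesis unfolding eq[OF st01(1,2)] eq[OF st01(3,4)] using st 2 by auto
    next
      case 3
      then have "(real l + 1) / M \<le> real k / M" by (intro divide_right_mono) auto
      then show ?thesis unfolding eq[OF st01(1,2)] eq[OF st01(3,4)] using st 3 by auto
    qed
  qed
  have "interpolant g M t - interpolant g M s = (\<Sum>k<M. m k * (if k = l then t - s else 0))"
    unfolding interpolant_def sum_subtractf[symmetric] m_def[symmetric] right_diff_distrib[symmetric]
    by (intro sum.cong) (auto simp: inc)
  also have "\<dots> = m l * (t - s)" using l by (simp add: if_distrib cong: if_cong)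
  finally show ?thesis by (simp add: m_def)
qed

lemma continuous_interpolant: "continuous_on {0..1} (interpolant g M)"
  unfolding interpolant_def
  by (intro continuous_intros continuous_arc_length) (auto simp: field_simps)

text \<open>Partition points are rounded down to the grid of mesh \<open>1 / (M * (K + 1))\<close>.
  By the triangle inequality the rounded sum is dominated by the full grid sum, and continuity of
  \<open>d\<close> lets \<open>K\<close> tend to infinity.\<close>

lemma partition_sum_le_grid:
  fixes d :: "real \<Rightarrow> real"
  assumes cont: "continuous_on {0..1} d" and M: "M > 0"
    and grid: "\<And>K. K > 0 \<Longrightarrow> (\<Sum>i<M * K. \<bar>d ((real i + 1) / (M * K)) - d (real i / (M * K))\<bar>) \<le> e"
    and t: "mono_on {..n::nat} t" "t ` {..n} \<subseteq> {0..1}"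
  shows "(\<Sum>i<n. \<bar>d (t (Suc i)) - d (t i)\<bar>) \<le> e"
proof -
  define N where "N K = M * Suc K" for K
  define k where "k K i = nat \<lfloor>t i * N K\<rfloor>" for K i
  have N: "N K > 0" for K using M by (simp add: N_def)
  have t01: "0 \<le> t i" "t i \<le> 1" if "i \<le> n" for i using t(2) that by auto
  have kN: "k K i \<le> N K" if "i \<le> n" for K i
  proof -
    have "t i * N K \<le> N K" using t01[OF that] by (simp add: mult_left_le_one_le)
    then show ?thesis unfolding k_def by linarith
  qed
  have kle: "real (k K i) \<le> t i * N K" and kgt: "t i * N K < real (k K i) + 1" if "i \<le> n" for K i
  proof -
    have "0 \<le> t i * N K" using t01[OF that] by simp
    then have "real (k K i) = of_int \<lfloor>t i * N K\<rfloor>" by (simp add: k_def)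
    then show "real (k K i) \<le> t i * N K" "t i * N K < real (k K i) + 1" by linarith+
  qed
  have step: "(\<Sum>i<n. \<bar>d (k K (Suc i) / N K) - d (k K i / N K)\<bar>) \<le> e" for K
  proof -
    define G where "G l = d (real l / N K)" for l
    have jump: "\<bar>G b - G a\<bar> \<le> (\<Sum>l = a..<b. \<bar>G (Suc l) - G l\<bar>)" if "a \<le> b" for a b
      using sum_abs[of "\<lambda>l. G (Suc l) - G l" "{a..<b}"] sum_Suc_diff'[OF that, of G] by simp
    have kmono: "k K i \<le> k K (Suc i)" if "i < n" for i
    proof -
      have "t i \<le> t (Suc i)" using that by (intro mono_onD[OF t(1)]) auto
      then show ?thesis unfolding k_def by (intro nat_mono floor_mono mult_right_mono) auto
    qed
    have "(\<Sum>i<j. \<bar>G (k K (Suc i)) - G (k K i)\<bar>) \<le> (\<Sum>l = k K 0..<k K j. \<bar>G (Suc l) - G l\<bar>)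
        \<and> k K 0 \<le> k K j" if "j \<le> n" for j
      using that
    proof (induction j)
      case (Suc j)
      then show ?case
        using jump[OF kmono[of j]] kmono[of j]
          sum.atLeastLessThan_concat[of "k K 0" "k K j" "k K (Suc j)" "\<lambda>l. \<bar>G (Suc l) - G l\<bar>"]
        by auto
    qed simp
    then have "(\<Sum>i<n. \<bar>G (k K (Suc i)) - G (k K i)\<bar>) \<le> (\<Sum>l = k K 0..<k K n. \<bar>G (Suc l) - G l\<bar>)"
      by blast
    also have "\<dots> \<le> (\<Sum>l<N K. \<bar>G (Suc l) - G l\<bar>)"
      using kN[of n K] by (intro sum_mono2) auto
    also have "\<dots> \<le> e" using grid[of "Suc K"] by (simp add: G_def N_def algebra_simps)
    finally show ?thesis by (simp add: G_def)
  qed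
  have lim: "(\<lambda>K. d (k K i / N K)) \<longlonglongrightarrow> d (t i)" if i: "i \<le> n" for i
  proof (rule continuous_on_tendsto_compose[OF cont])
    have "\<bar>k K i / N K - t i\<bar> \<le> inverse (real (Suc K))" for K
    proof -
      have "k K i / N K - t i = (k K i - t i * N K) / N K" using N[of K] by (simp add: diff_divide_distrib)
      then have "\<bar>k K i / N K - t i\<bar> = \<bar>k K i - t i * N K\<bar> / N K" by simp
      also have "\<dots> \<le> 1 / N K" using kle[OF i, of K] kgt[OF i, of K] by (intro divide_right_mono) auto
      also have "\<dots> \<le> 1 / Suc K"
      proof (intro divide_left_mono)
        have "1 * Suc K \<le> M * Suc K" using M by (intro mult_le_mono1) auto
        then show "real (Suc K) \<le> real (N K)" by (simp add: N_def del: of_nat_Suc mult_Suc_right)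
        show "0 < real (N K) * real (Suc K)" using N by simp
      qed auto
      finally show ?thesis by (simp add: inverse_eq_divide)
    qed
    then have "(\<lambda>K. k K i / N K - t i) \<longlonglongrightarrow> 0"
      by (intro Lim_null_comparison[OF _ LIMSEQ_inverse_real_of_nat]) auto
    then show "(\<lambda>K. k K i / N K) \<longlonglongrightarrow> t i" by (simp add: LIM_zero_iff)
    show "t i \<in> {0..1}" using t01[OF i] by simp
    show "\<forall>\<^sub>F K in sequentially. k K i / N K \<in> {0..1}"
      using kN[OF i] N by (auto simp: field_simps)
  qed
  have "(\<lambda>K. \<Sum>i<n. \<bar>d (k K (Suc i) / N K) - d (k K i / N K)\<bar>)
      \<longlonglongrightarrow> (\<Sum>i<n. \<bar>d (t (Suc i)) - d (t i)\<bar>)"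
    by (intro tendsto_intros lim) auto
  then show ?thesis using step by (intro LIMSEQ_le_const2) auto
qed

text \<open>The length of the graph of the piecewise linear interpolant measures the quality of the
  interpolation: it increases under refinement, and since \<open>\<lambda>s. sqrt (1 + s\<^sup>2)\<close> is strictly convex, a small
  increase means that the slopes hardly change, except where they are large; absolute continuity
  makes the variation carried by the large slopes negligible.\<close>

definition graph_length :: "(real \<Rightarrow> real) \<Rightarrow> nat \<Rightarrow> real" where
  "graph_length g M = (\<Sum>l<M. sqrt (1 + (real M * (g ((real l + 1) / M) - g (real l / M)))\<^sup>2)) / M"

text \<open>The gap at \<open>b\<close> between \<open>\<lambda>s. sqrt (1 + s\<^sup>2)\<close> and
  its tangent at \<open>a\<close>. Summed over slopes \<open>b\<close> with mean \<open>a\<close>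
  the tangent terms cancel, which leaves the gain in graph length under refinement.\<close>

definition bregman_sqrt :: "real \<Rightarrow> real \<Rightarrow> real" where
  "bregman_sqrt b a = sqrt (1 + b\<^sup>2) - sqrt (1 + a\<^sup>2) - a / sqrt (1 + a\<^sup>2) * (b - a)"

text \<open>With \<open>A = sqrt (1 + a\<^sup>2)\<close> and \<open>B = sqrt (1 + b\<^sup>2)\<close>
  the gap is \<open>(A * B - (1 + a * b)) / A\<close>, and
  \<open>(A * B)\<^sup>2 - (1 + a * b)\<^sup>2 = (b - a)\<^sup>2\<close> is Lagrange's identity for
  the vectors \<open>(1, a)\<close> and \<open>(1, b)\<close>. The other factor
  \<open>A * B + (1 + a * b)\<close> is at most \<open>2 * A * B\<close>.\<close>

lemma bregman_sqrt_ge: "bregman_sqrt b a \<ge> (b - a)\<^sup>2 / (2 * (sqrt (1 + a\<^sup>2))\<^sup>2 * sqrt (1 + b\<^sup>2))"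
proof -
  define A where "A = sqrt (1 + a\<^sup>2)"
  define B where "B = sqrt (1 + b\<^sup>2)"
  have pos: "A > 0" "B > 0" by (simp_all add: A_def B_def add_pos_nonneg)
  have sq: "A\<^sup>2 = 1 + a\<^sup>2" "B\<^sup>2 = 1 + b\<^sup>2" by (simp_all add: A_def B_def)
  have "bregman_sqrt b a = (A * B - A\<^sup>2 - a * (b - a)) / A"
    unfolding bregman_sqrt_def A_def[symmetric] B_def[symmetric]
    using pos by (simp add: field_simps power2_eq_square)
  also have "A * B - A\<^sup>2 - a * (b - a) = A * B - (1 + a * b)"
    unfolding sq by (simp add: algebra_simps power2_eq_square)
  finally have eq: "bregman_sqrt b a = (A * B - (1 + a * b)) / A" .
  have prod: "(A * B - (1 + a * b)) * (A * B + (1 + a * b)) = (b - a)\<^sup>2"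
  proof -
    have "(A * B - (1 + a * b)) * (A * B + (1 + a * b)) = A\<^sup>2 * B\<^sup>2 - (1 + a * b)\<^sup>2"
      by (simp add: algebra_simps power2_eq_square)
    then show ?thesis unfolding sq by (simp add: algebra_simps power2_eq_square)
  qed
  have "(A * B)\<^sup>2 - (1 + a * b)\<^sup>2 = (b - a)\<^sup>2"
    using prod by (simp add: algebra_simps power2_eq_square)
  then have "(1 + a * b)\<^sup>2 \<le> (A * B)\<^sup>2" using zero_le_power2[of "b - a"] by linarith
  then have "\<bar>1 + a * b\<bar> \<le> \<bar>A * B\<bar>" by (simp only: abs_le_square_iff)
  then have "\<bar>1 + a * b\<bar> \<le> A * B" using pos by (simp add: abs_mult)
  then have le: "0 \<le> A * B - (1 + a * b)" "A * B + (1 + a * b) \<le> 2 * (A * B)" by linarith+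
  then have "(b - a)\<^sup>2 \<le> (A * B - (1 + a * b)) * (2 * (A * B))"
    unfolding prod[symmetric] by (intro mult_left_mono)
  then have "(b - a)\<^sup>2 / (2 * A\<^sup>2 * B) \<le> (A * B - (1 + a * b)) * (2 * (A * B)) / (2 * A\<^sup>2 * B)"
    using pos by (intro divide_right_mono) auto
  also have "\<dots> = (A * B - (1 + a * b)) / A" using pos by (simp add: field_simps power2_eq_square)
  finally show ?thesis unfolding eq A_def B_def .
qed

lemma bregman_sqrt_nonneg: "bregman_sqrt b a \<ge> 0"
  by (rule order_trans[OF _ bregman_sqrt_ge]) (simp add: add_nonneg_nonneg)

text \<open>For slopes bounded by \<open>T\<close> the gap controls \<open>(b - a)\<^sup>2\<close>,
  and a number \<open>d \<ge> 0\<close> is at most \<open>e + d\<^sup>2 / e\<close>. If a slope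
  exceeds \<open>T\<close>, the difference is at most twice the larger slope, whence the factors
  2.\<close>

lemma slope_difference_le:
  assumes e: "e > 0" and T: "T > 0"
  shows "\<bar>b - a\<bar> \<le> e + 2 * (1 + T) ^ 3 / e * bregman_sqrt b a
    + 2 * (if \<bar>b\<bar> > T then \<bar>b\<bar> else 0) + 2 * (if \<bar>a\<bar> > T then \<bar>a\<bar> else 0)"
proof (cases "\<bar>b\<bar> > T \<or> \<bar>a\<bar> > T")
  case True
  have "0 \<le> 2 * (1 + T) ^ 3 / e * bregman_sqrt b a"
    using e T bregman_sqrt_nonneg by (intro mult_nonneg_nonneg) auto
  then show ?thesis using True e by (auto simp: abs_if split: if_splits)
next
  case False
  define C where "C = (1 + T) ^ 3"
  have C: "C > 0" using T by (simp add: C_def)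
  have sq: "sqrt (1 + x\<^sup>2) \<le> 1 + T" if "\<bar>x\<bar> \<le> T" for x
  proof (rule real_le_lsqrt)
    have "x\<^sup>2 \<le> T\<^sup>2" using that T abs_le_square_iff[of x T] by simp
    then show "1 + x\<^sup>2 \<le> (1 + T)\<^sup>2" using T by (simp add: power2_sum)
  qed (use T in auto)
  have "(sqrt (1 + a\<^sup>2))\<^sup>2 * sqrt (1 + b\<^sup>2) \<le> (1 + T)\<^sup>2 * (1 + T)"
    using False T by (intro mult_mono power_mono sq) auto
  also have "(1 + T)\<^sup>2 * (1 + T) = C" by (simp add: C_def power3_eq_cube power2_eq_square)
  finally have den: "2 * (sqrt (1 + a\<^sup>2))\<^sup>2 * sqrt (1 + b\<^sup>2) \<le> 2 * C"
    unfolding mult.assoc by (rule mult_left_mono) simp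
  have pos: "0 < 2 * (sqrt (1 + a\<^sup>2))\<^sup>2 * sqrt (1 + b\<^sup>2)"
    by (simp add: add_pos_nonneg)
  have "(b - a)\<^sup>2 / (2 * C) \<le> (b - a)\<^sup>2 / (2 * (sqrt (1 + a\<^sup>2))\<^sup>2 * sqrt (1 + b\<^sup>2))"
    using den pos C by (intro divide_left_mono) auto
  also note bregman_sqrt_ge
  finally have br: "(b - a)\<^sup>2 \<le> 2 * C * bregman_sqrt b a" using C by (simp add: field_simps)
  have "\<bar>b - a\<bar> * e \<le> e * e + (b - a)\<^sup>2"
  proof (cases "\<bar>b - a\<bar> \<le> e")
    case True
    then have "\<bar>b - a\<bar> * e \<le> e * e" using e by (intro mult_right_mono) auto
    then show ?thesis by (simp add: add_increasing2)
  next
    case False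
    then have "\<bar>b - a\<bar> * e \<le> \<bar>b - a\<bar> * \<bar>b - a\<bar>" by (intro mult_left_mono) auto
    then show ?thesis using e by (simp add: power2_eq_square add_increasing)
  qed
  also have "\<dots> \<le> (e + 2 * C / e * bregman_sqrt b a) * e" using br e by (simp add: algebra_simps)
  finally have "\<bar>b - a\<bar> \<le> e + 2 * C / e * bregman_sqrt b a" using e by simp
  then show ?thesis using False by (simp add: C_def)
qed

text \<open>A Chebyshev estimate: the cells with slope above \<open>T\<close> have total length at
  most \<open>w / T < \<delta>\<close>, so absolute continuity applies to them.\<close>

lemma sum_large_slopes_le:
  assumes w: "variation_le g w" and e: "e > 0" and \<delta>: "\<delta> > 0" and T: "T > w / \<delta>" "T > 0"
    and ac: "\<And>n u v. (\<forall>i<n. 0 \<le> u i \<and> u i \<le> v i \<and> v i \<le> 1) \<Longrightarrow>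
        disjoint_family_on (\<lambda>i::nat. {u i<..<v i}) {..<n} \<Longrightarrow>
        (\<Sum>i<n. v i - u i) < \<delta> \<Longrightarrow> (\<Sum>i<n. \<bar>g (v i) - g (u i)\<bar>) < e"
    and N: "N > 0"
  defines "b \<equiv> \<lambda>i::nat. real N * (g ((real i + 1) / N) - g (real i / N))"
  shows "(\<Sum>i<N. if \<bar>b i\<bar> > T then \<bar>b i\<bar> else 0) / N \<le> e"
proof -
  \<comment> \<open>Cells with moderate slope are collapsed to a point, so that the family can stay
    indexed by all \<open>N\<close> cells.\<close>
  define v where "v i = (if \<bar>b i\<bar> > T then (real i + 1) / N else real i / N)" for i
  have uv: "\<forall>i<N. 0 \<le> real i / N \<and> real i / N \<le> v i \<and> v i \<le> 1"
    using N by (auto simp: v_def field_simps)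
  have "disjoint_family_on (\<lambda>i. {real i / N<..<(real i + 1) / N}) {..<N}"
    unfolding disjoint_family_on_def
  proof (intro ballI impI)
    have *: "{real i / N<..<(real i + 1) / N} \<inter> {real j / N<..<(real j + 1) / N} = {}" if "i < j" for i j
    proof -
      have "(real i + 1) / N \<le> real j / N" using that by (intro divide_right_mono) auto
      then show ?thesis by auto
    qed
    fix i j :: nat assume "i \<noteq> j"
    then show "{real i / N<..<(real i + 1) / N} \<inter> {real j / N<..<(real j + 1) / N} = {}"
      using *[of i j] *[of j i] by (metis inf_commute nat_neq_iff)
  qed
  then have disj: "disjoint_family_on (\<lambda>i. {real i / N<..<v i}) {..<N}"
    by (rule disjoint_family_on_bisimulation) (auto simp: v_def split: if_splits)
  have vu: "v i - real i / N = (if \<bar>b i\<bar> > T then 1 / N else 0)" for i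
    by (simp add: v_def add_divide_distrib)
  have gb: "\<bar>g ((real i + 1) / N) - g (real i / N)\<bar> = \<bar>b i\<bar> / N" for i
    using N by (simp add: b_def abs_mult)
  have "(\<Sum>i<N. v i - real i / N) \<le> (\<Sum>i<N. \<bar>g ((real i + 1) / N) - g (real i / N)\<bar> / T)"
    unfolding vu gb using T(2) N by (intro sum_mono) (auto simp: field_simps)
  also have "\<dots> \<le> w / T"
    unfolding sum_divide_distrib[symmetric]
    using sum_abs_grid_increments[OF w N] T(2) by (intro divide_right_mono) auto
  also have "\<dots> < \<delta>" using T \<delta> by (simp add: field_simps)
  finally have "(\<Sum>i<N. \<bar>g (v i) - g (real i / N)\<bar>) < e" by (rule ac[OF uv disj])
  moreover have "\<bar>g (v i) - g (real i / N)\<bar> = (if \<bar>b i\<bar> > T then \<bar>b i\<bar> else 0) / N" for i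
    by (simp add: v_def gb)
  ultimately show ?thesis by (simp flip: sum_divide_distrib)
qed

lemma graph_length_le:
  assumes "variation_le g w" "M > 0"
  shows "graph_length g M \<le> 1 + w"
proof -
  have "sqrt (1 + x\<^sup>2) \<le> 1 + \<bar>x\<bar>" for x :: real
    by (rule real_le_lsqrt) (auto simp: power2_sum)
  then have "graph_length g M \<le> (\<Sum>l<M. 1 + \<bar>real M * (g ((real l + 1) / M) - g (real l / M))\<bar>) / M"
    unfolding graph_length_def by (intro divide_right_mono sum_mono) auto
  also have "\<dots> = 1 + (\<Sum>l<M. \<bar>g ((real l + 1) / M) - g (real l / M)\<bar>)"
    using assms(2) by (simp add: sum.distrib abs_mult add_divide_distrib flip: sum_distrib_left)
  finally show ?thesis using sum_abs_grid_increments[OF assms] by linarith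
qed

lemma sum_refined_grid:
  fixes f :: "nat \<Rightarrow> real"
  shows "(\<Sum>L<M. \<Sum>j<K. f (L * K + j)) = (\<Sum>i<M * K. f i)"
proof -
  have "(\<Sum>L<M. \<Sum>j<K. f (L * K + j)) = (\<Sum>L<M. sum f {L * K..<L * K + K})"
  proof (rule sum.cong[OF refl])
    fix L
    show "(\<Sum>j<K. f (L * K + j)) = sum f {L * K..<L * K + K}"
      using sum.shift_bounds_nat_ivl[of f 0 "L * K" K] by (simp add: add.commute lessThan_atLeast0)
  qed
  then show ?thesis by (simp add: sum.nat_group)
qed

text \<open>The graph lengths are bounded, so some grid has almost maximal length, and then no
  refinement can gain more than \<open>e1 / C\<close>. Hence the slopes on every refinement are
  close in mean to those on the coarse grid, and for continuous functions refinements suffice to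
  bound the variation.\<close>

theorem interpolant_approximates:
  assumes cont: "continuous_on UNIV g" and per: "\<And>t. g (t + 1) = g t"
    and w: "variation_le g w" and ac: "absolutely_continuous_on 0 1 g" and e: "e > 0"
  shows "\<exists>M>0. variation_le (\<lambda>t. g t - interpolant g M t) e"
proof -
  \<comment> \<open>Six shares: one for the additive term, one for the gain in length, and two each
    for the large slopes on the fine and on the coarse grid.\<close>
  define e1 where "e1 = e / 6"
  have e1: "e1 > 0" using e by (simp add: e1_def)
  obtain \<delta> where \<delta>: "\<delta> > 0" and ac': "\<And>n u v. (\<forall>i<n. 0 \<le> u i \<and> u i \<le> v i \<and> v i \<le> 1) \<Longrightarrow>
        disjoint_family_on (\<lambda>i::nat. {u i<..<v i}) {..<n} \<Longrightarrow>
        (\<Sum>i<n. v i - u i) < \<delta> \<Longrightarrow> (\<Sum>i<n. \<bar>g (v i) - g (u i)\<bar>) < e1"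
    using ac e1 unfolding absolutely_continuous_on_def by meson
  define T where "T = w / \<delta> + 1"
  have T: "T > w / \<delta>" "T > 0"
    using variation_le_nonneg[OF w] \<delta> by (auto simp: T_def add_nonneg_pos)
  note large = sum_large_slopes_le[OF w e1 \<delta> T ac']
  define C where "C = 2 * (1 + T) ^ 3 / e1"
  have C: "C > 0" using e1 T by (simp add: C_def)
  define S where "S = Sup (graph_length g ` {1..})"
  have bdd: "bdd_above (graph_length g ` {1..})"
    using graph_length_le[OF w] by (intro bdd_aboveI[of _ "1 + w"]) auto
  have "S - e1 / C < Sup (graph_length g ` {1..})" using e1 C by (simp add: S_def)
  then obtain M where M: "M \<ge> 1" "S - e1 / C < graph_length g M"
    by (rule less_cSupE) auto
  define a where "a L = real M * (g ((real L + 1) / M) - g (real L / M))" for L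
  define d where "d t = g t - interpolant g M t" for t
  have grid: "(\<Sum>i<M * K. \<bar>d ((real i + 1) / (M * K)) - d (real i / (M * K))\<bar>) \<le> e" if K: "K > 0" for K
  proof -
    define N where "N = M * K"
    have N: "N > 0" using M K by (simp add: N_def)
    have MK: "real M > 0" "real K > 0" using M K by auto
    have rN: "real N = real M * real K" by (simp add: N_def)
    define b where "b i = real N * (g ((real i + 1) / N) - g (real i / N))" for i
    have dinc: "\<bar>d ((real (L * K + j) + 1) / N) - d (real (L * K + j) / N)\<bar>
        = \<bar>b (L * K + j) - a L\<bar> / N" if "L < M" "j < K" for L j
    proof -
      have "real L / M \<le> real (L * K + j) / N" using MK rN by (simp add: field_simps)
      moreover have "(real (L * K + j) + 1) / N \<le> (real L + 1) / M"
      proof -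
        have "real (L * K + j) + 1 \<le> (real L + 1) * real K"
          using that(2) by (simp add: algebra_simps)
        then have "(real (L * K + j) + 1) / N \<le> ((real L + 1) * real K) / N"
          by (rule divide_right_mono) simp
        also have "\<dots> = (real L + 1) / M" using MK rN by simp
        finally show ?thesis .
      qed
      ultimately have "interpolant g M ((real (L * K + j) + 1) / N) - interpolant g M (real (L * K + j) / N)
          = a L * ((real (L * K + j) + 1) / N - real (L * K + j) / N)"
        unfolding a_def by (intro interpolant_diff_cell that(1)) (auto intro!: divide_right_mono)
      also have "\<dots> = a L / N" by (simp flip: diff_divide_distrib)
      finally have "d ((real (L * K + j) + 1) / N) - d (real (L * K + j) / N) = (b (L * K + j) - a L) / N"
        using N by (simp add: d_def b_def diff_divide_distrib)
      then show ?thesis by simp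
    qed
    have bsum: "(\<Sum>j<K. b (L * K + j)) = K * a L" for L
    proof -
      have "(\<Sum>j<K. g ((real (L * K + j) + 1) / N) - g (real (L * K + j) / N))
          = g ((real L * K + K) / N) - g (real L * K / N)"
        using sum_lessThan_telescope[of "\<lambda>j. g ((real L * K + real j) / N)" K]
        by (simp add: algebra_simps)
      then have "(\<Sum>j<K. b (L * K + j)) = N * (g ((real L * K + K) / N) - g (real L * K / N))"
        unfolding b_def sum_distrib_left[symmetric] by simp
      also have "(real L * K + K) / N = (real L + 1) / M" using MK by (simp add: rN field_simps)
      also have "real L * K / N = real L / M" using MK by (simp add: rN field_simps)
      finally show ?thesis by (simp add: a_def rN)
    qed
    have breg: "(\<Sum>L<M. \<Sum>j<K. bregman_sqrt (b (L * K + j)) (a L)) / N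
        = graph_length g N - graph_length g M"
    proof -
      have "(\<Sum>j<K. bregman_sqrt (b (L * K + j)) (a L))
          = (\<Sum>j<K. sqrt (1 + (b (L * K + j))\<^sup>2)) - K * sqrt (1 + (a L)\<^sup>2)" for L
      proof -
        have "(\<Sum>j<K. a L / sqrt (1 + (a L)\<^sup>2) * (b (L * K + j) - a L))
            = a L / sqrt (1 + (a L)\<^sup>2) * (\<Sum>j<K. b (L * K + j) - a L)"
          by (rule sum_distrib_left[symmetric])
        also have "\<dots> = 0" by (simp add: sum_subtractf bsum)
        finally show ?thesis unfolding bregman_sqrt_def sum_subtractf by simp
      qed
      then have "(\<Sum>L<M. \<Sum>j<K. bregman_sqrt (b (L * K + j)) (a L))
          = (\<Sum>i<N. sqrt (1 + (b i)\<^sup>2)) - K * (\<Sum>L<M. sqrt (1 + (a L)\<^sup>2))"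
        using sum_refined_grid[of "\<lambda>i. sqrt (1 + (b i)\<^sup>2)" K M]
        by (simp add: sum_subtractf N_def flip: sum_distrib_left)
      then show ?thesis using MK
        by (simp add: graph_length_def a_def b_def rN diff_divide_distrib)
    qed
    have "graph_length g N \<le> S" unfolding S_def using N by (intro cSup_upper bdd) auto
    then have "graph_length g N - graph_length g M \<le> e1 / C" using M by linarith
    then have breg_le: "C * (graph_length g N - graph_length g M) \<le> e1"
      using C by (simp add: field_simps)
    define bb where "bb i = (if \<bar>b i\<bar> > T then \<bar>b i\<bar> else 0)" for i
    define aa where "aa L = (if \<bar>a L\<bar> > T then \<bar>a L\<bar> else 0)" for L
    have "(\<Sum>i<N. \<bar>d ((real i + 1) / N) - d (real i / N)\<bar>)
        = (\<Sum>L<M. \<Sum>j<K. \<bar>b (L * K + j) - a L\<bar>) / N"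
      unfolding N_def sum_refined_grid[symmetric] sum_divide_distrib
      using dinc by (intro sum.cong refl) (auto simp: N_def)
    also have "\<dots> \<le> (\<Sum>L<M. \<Sum>j<K. e1 + C * bregman_sqrt (b (L * K + j)) (a L)
        + 2 * bb (L * K + j) + 2 * aa L) / N"
      unfolding C_def bb_def aa_def
      by (intro divide_right_mono sum_mono slope_difference_le e1 T) auto
    also have "\<dots> = (\<Sum>L<M. \<Sum>j<K. e1) / N
        + C * ((\<Sum>L<M. \<Sum>j<K. bregman_sqrt (b (L * K + j)) (a L)) / N)
        + 2 * ((\<Sum>L<M. \<Sum>j<K. bb (L * K + j)) / N) + 2 * ((\<Sum>L<M. \<Sum>j<K. aa L) / N)"
      by (simp only: sum.distrib sum_distrib_left[symmetric] add_divide_distrib times_divide_eq_right)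
    also have "(\<Sum>L<M. \<Sum>j<K. e1) / N = e1" using MK by (simp add: rN)
    also have "(\<Sum>L<M. \<Sum>j<K. bb (L * K + j)) / N = (\<Sum>i<N. bb i) / N"
      by (simp add: sum_refined_grid N_def)
    also have "(\<Sum>L<M. \<Sum>j<K. aa L) / N = (\<Sum>L<M. aa L) / M"
      using MK by (simp add: rN flip: sum_distrib_left)
    finally have "(\<Sum>i<N. \<bar>d ((real i + 1) / N) - d (real i / N)\<bar>)
      \<le> e1 + C * (graph_length g N - graph_length g M) + 2 * ((\<Sum>i<N. bb i) / N) + 2 * ((\<Sum>L<M. aa L) / M)"
      unfolding breg .
    moreover have "(\<Sum>i<N. bb i) / N \<le> e1" "(\<Sum>L<M. aa L) / M \<le> e1"
      unfolding bb_def aa_def a_def b_def using N M by (auto intro!: large)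
    ultimately have "(\<Sum>i<N. \<bar>d ((real i + 1) / N) - d (real i / N)\<bar>) \<le> e"
      using breg_le by (simp add: e1_def)
    then show ?thesis by (simp add: N_def)
  qed
  have "variation_le d e"
  proof (rule variation_le_of_partitions)
    show "d (t + 1) = d t" for t
      unfolding d_def using M per[of 0] by (subst interpolant_shift) (auto simp: per)
    have "continuous_on {0..1} d"
      unfolding d_def
      by (intro continuous_intros continuous_interpolant continuous_on_subset[OF cont]) auto
    then show "(\<Sum>i<n. \<bar>d (t (Suc i)) - d (t i)\<bar>) \<le> e"
      if "mono_on {..n} t" "t ` {..n} \<subseteq> {0..1}" for n t
      using M grid that by (intro partition_sum_le_grid[where M = M]) auto
  qed
  then show ?thesis using M unfolding d_def by (intro exI[of _ M]) auto
qed

section \<open>Order structure of the orbits\<close>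

text \<open>The rotation by \<open>p / q\<close> reaches \<open>j / q\<close> after
  \<open>ii j = j * u\<close> steps modulo \<open>q\<close>, where \<open>u\<close> inverts
  \<open>p\<close> modulo \<open>q\<close>; \<open>mm j\<close> corrects for full turns, so that
  \<open>ii j * p + mm j * q = j\<close>. Replacing \<open>p / q\<close> by \<open>\<alpha>\<close>
  moves these points by less than \<open>1 / q\<close>.\<close>

lemma rational_rotation_order:
  assumes "good_approx \<alpha> p q"
  obtains ii :: "int \<Rightarrow> nat" and mm :: "int \<Rightarrow> int" where
    "\<And>j. ii j < q" "\<And>j. \<bar>real (ii j) * \<alpha> + of_int (mm j) - of_int j / real q\<bar> < 1 / real q"
    "\<And>j. ii (j + int q) = ii j" "\<And>j. mm (j + int q) = mm j + 1" "ii 0 = 0" "mm 0 = 0"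
    "\<And>k. bij_betw (\<lambda>i. ii (k + int i)) {..<q} {..<q}"
proof -
  have q: "q > 0" and cop: "coprime p (int q)" and err: "\<bar>real q * \<alpha> - of_int p\<bar> < 1 / real q"
    using assms by (auto simp: good_approx_def)
  obtain u v where uv: "u * p + v * int q = 1" using bezout_int[of p "int q"] cop by auto
  define ii where "ii j = nat ((j * u) mod int q)" for j
  define mm where "mm j = (j - int (ii j) * p) div int q" for j
  have ii: "int (ii j) = (j * u) mod int q" for j using q by (simp add: ii_def)
  have rel: "int (ii j) * p + mm j * int q = j" for j
  proof -
    have "int (ii j) = j * u - (j * u) div int q * int q" unfolding ii by (simp add: minus_div_mult_eq_mod)
    then have "j - int (ii j) * p = j - (j * u - (j * u) div int q * int q) * p" by simp
    also have "\<dots> = j * (1 - u * p) + (j * u) div int q * p * int q" by (simp add: algebra_simps)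
    also have "\<dots> = (j * v + (j * u) div int q * p) * int q"
      using uv by (simp add: algebra_simps flip: uv)
    finally have "int q dvd j - int (ii j) * p" by simp
    then show ?thesis by (simp add: mm_def)
  qed
  have lt: "ii j < q" for j
    using ii[of j] q pos_mod_bound[of "int q" "j * u"] by linarith
  have per: "ii (j + int q) = ii j" for j by (simp add: ii_def algebra_simps)
  have mper: "mm (j + int q) = mm j + 1" for j
  proof -
    have "mm (j + int q) * int q = (mm j + 1) * int q"
      using rel[of "j + int q"] rel[of j] by (simp add: per algebra_simps)
    then show ?thesis using q by simp
  qed
  have close: "\<bar>real (ii j) * \<alpha> + of_int (mm j) - of_int j / real q\<bar> < 1 / real q" for j
  proof -
    have "of_int (int (ii j) * p + mm j * int q) = (of_int j :: real)" using rel by simp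
    then have "of_int j / real q = (real (ii j) * of_int p + of_int (mm j) * real q) / real q" by simp
    then have "real (ii j) * \<alpha> + of_int (mm j) - of_int j / real q
        = real (ii j) * (real q * \<alpha> - of_int p) / q"
      using q by (simp add: field_simps)
    then have "\<bar>real (ii j) * \<alpha> + of_int (mm j) - of_int j / real q\<bar>
        = real (ii j) * \<bar>real q * \<alpha> - of_int p\<bar> / q" by (simp add: abs_mult)
    also have "\<dots> \<le> real q * \<bar>real q * \<alpha> - of_int p\<bar> / q"
      using lt[of j] by (intro divide_right_mono mult_right_mono) auto
    also have "\<dots> < 1 / real q" using err q by simp
    finally show ?thesis .
  qed
  have bij: "bij_betw (\<lambda>i. ii (k + int i)) {..<q} {..<q}" for k
  proof -
    have "inj_on (\<lambda>i. ii (k + int i)) {..<q}"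
    proof (rule inj_onI)
      fix i j assume ij: "i \<in> {..<q}" "j \<in> {..<q}" "ii (k + int i) = ii (k + int j)"
      then have "int i - int j = (mm (k + int i) - mm (k + int j)) * int q"
        using rel[of "k + int i"] rel[of "k + int j"] by (simp add: algebra_simps)
      then have "int q dvd int i - int j" by simp
      moreover have "\<bar>int i - int j\<bar> < int q" using ij by auto
      ultimately have "int i - int j = 0" using dvd_imp_le_int[of "int i - int j" "int q"] by linarith
      then show "i = j" by simp
    qed
    moreover have "(\<lambda>i. ii (k + int i)) ` {..<q} \<subseteq> {..<q}" using lt by auto
    ultimately show ?thesis
      by (intro bij_betw_imageI endo_inj_surj) auto
  qed
  have "ii 0 = 0" "mm 0 = 0" by (simp_all add: mm_def ii_def)
  then show thesis by (rule that[OF lt close per mper _ _ bij])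
qed

text \<open>Moving the window one place to the right exchanges \<open>h k\<close> for
  \<open>h (k + q)\<close>, which is larger by \<open>w\<close>.\<close>

lemma window_sum_shift:
  fixes h :: "int \<Rightarrow> real"
  assumes "\<And>j. h (j + int q) = h j + w"
  shows "(\<Sum>i<q. h (k + int i)) = (\<Sum>i<q. h (int i)) + of_int k * w"
proof -
  have step: "(\<Sum>i<q. h (k + 1 + int i)) = (\<Sum>i<q. h (k + int i)) + w" for k
  proof -
    have "(\<Sum>i<q. h (k + int (Suc i)) - h (k + int i)) = w"
      using sum_lessThan_telescope[of "\<lambda>i. h (k + int i)" q] assms[of k] by simp
    then show ?thesis by (simp add: sum_subtractf algebra_simps)
  qed
  show ?thesis
  proof (induction k rule: int_induct[where k = 0])
    case (step1 i)
    then show ?case using step[of i] by (simp add: algebra_simps)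
  next
    case (step2 i)
    then show ?case using step[of "i - 1"] by (simp add: algebra_simps)
  qed simp
qed

section \<open>Monotone lifts of degree one and their translation number\<close>

locale circle_lift =
  fixes F :: "real \<Rightarrow> real"
  assumes strict_mono_lift: "strict_mono F" and lift_shift: "F (t + 1) = F t + 1"
begin

lemma iter_less_iff [simp]: "(F ^^ n) x < (F ^^ n) y \<longleftrightarrow> x < y"
  by (induction n) (auto simp: strict_mono_less[OF strict_mono_lift])

lemma iter_le_iff [simp]: "(F ^^ n) x \<le> (F ^^ n) y \<longleftrightarrow> x \<le> y"
  by (simp flip: not_less)

lemma mono_iter: "mono (F ^^ n)"
  by (auto intro: monoI)

lemma iter_shift: "(F ^^ n) (t + 1) = (F ^^ n) t + 1"
  by (induction n) (auto simp: lift_shift)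

lemma iter_shift_int [simp]: "(F ^^ n) (t + of_int k) = (F ^^ n) t + of_int k"
  using degree_shift_int[of "F ^^ n" 1] iter_shift by simp

text \<open>Compare \<open>t\<close> with the integers on either side of it, which are displaced
  exactly as 0 is.\<close>

lemma iter_displacement: "\<bar>(F ^^ n) t - t - (F ^^ n) 0\<bar> \<le> 1"
proof -
  have "(F ^^ n) (0 + of_int \<lfloor>t\<rfloor>) \<le> (F ^^ n) t" "(F ^^ n) t \<le> (F ^^ n) (0 + of_int (\<lfloor>t\<rfloor> + 1))"
    unfolding iter_le_iff by linarith+
  then show ?thesis unfolding iter_shift_int by (simp add: abs_le_iff) linarith
qed

text \<open>By \<open>iter_displacement\<close>, \<open>(F ^^ (n * m)) 0\<close> equals
  \<open>m * (F ^^ n) 0\<close> up to \<open>m\<close>. Exchanging \<open>n\<close> and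
  \<open>m\<close> and dividing by \<open>n * m\<close> makes the averages Cauchy.\<close>

lemma rotation_limit_exists: "\<exists>\<tau>. \<forall>t. (\<lambda>n. (F ^^ n) t / real n) \<longlonglongrightarrow> \<tau>"
proof -
  define a where "a n = (F ^^ n) 0" for n
  have quasi: "\<bar>a (n * m) - m * a n\<bar> \<le> m" for n m
  proof (induction m)
    case (Suc m)
    have "a (n * Suc m) = (F ^^ n) (a (n * m))" by (simp add: a_def funpow_add)
    then have "\<bar>a (n * Suc m) - a (n * m) - a n\<bar> \<le> 1"
      using iter_displacement[of n "a (n * m)"] by (simp add: a_def)
    then show ?case using Suc by (simp add: algebra_simps)
  qed (simp add: a_def)
  have cauchy: "\<bar>a n / n - a m / m\<bar> \<le> 1 / n + 1 / m" if "n > 0" "m > 0" for n m :: nat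
  proof -
    have "\<bar>m * a n - n * a m\<bar> \<le> m + n"
      using quasi[of n m] quasi[of m n] by (simp add: mult.commute)
    then have "\<bar>m * a n - n * a m\<bar> / (n * m) \<le> (m + n) / (n * m)" by (rule divide_right_mono) simp
    moreover have "(m * a n - n * a m) / (n * m) = a n / n - a m / m" using that by (simp add: field_simps)
    then have "\<bar>m * a n - n * a m\<bar> / (n * m) = \<bar>a n / n - a m / m\<bar>" by (metis abs_divide abs_of_nat)
    moreover have "(m + n) / (n * m) = 1 / real n + 1 / m" using that by (simp add: field_simps)
    ultimately show ?thesis by simp
  qed
  have "Cauchy (\<lambda>n. a n / real n)"
  proof (rule metric_CauchyI)
    fix e :: real assume e: "e > 0"
    then obtain M where M: "M > 0" "inverse (real M) < e / 2"
      using ex_inverse_of_nat_less[of "e / 2"] by auto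
    show "\<exists>M. \<forall>m\<ge>M. \<forall>n\<ge>M. dist (a m / real m) (a n / real n) < e"
    proof (intro exI[of _ M] allI impI)
      fix m n assume mn: "M \<le> m" "M \<le> n"
      have "1 / real m \<le> 1 / M" "1 / real n \<le> 1 / M" using mn M by (auto intro!: divide_left_mono)
      then show "dist (a m / real m) (a n / real n) < e"
        using cauchy[of m n] mn M by (simp add: dist_real_def inverse_eq_divide)
    qed
  qed
  then obtain \<tau> where \<tau>: "(\<lambda>n. a n / real n) \<longlonglongrightarrow> \<tau>" using Cauchy_convergent convergentD by blast
  have "(\<lambda>n. (F ^^ n) t / real n) \<longlonglongrightarrow> \<tau>" for t
  proof -
    have "(\<lambda>n. (F ^^ n) t / real n - a n / real n) \<longlonglongrightarrow> 0"
    proof (rule Lim_null_comparison)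
      have "norm ((F ^^ n) t / real n - a n / real n) \<le> (\<bar>t\<bar> + 1) / real n" for n
      proof -
        have "\<bar>(F ^^ n) t - a n\<bar> \<le> \<bar>t\<bar> + 1" using iter_displacement[of n t] by (simp add: a_def)
        then have "\<bar>(F ^^ n) t - a n\<bar> / n \<le> (\<bar>t\<bar> + 1) / n" by (rule divide_right_mono) simp
        then show ?thesis by (simp add: diff_divide_distrib[symmetric])
      qed
      then show "\<forall>\<^sub>F n in sequentially. norm ((F ^^ n) t / real n - a n / real n) \<le> (\<bar>t\<bar> + 1) / real n"
        by simp
      show "(\<lambda>n. (\<bar>t\<bar> + 1) / real n) \<longlonglongrightarrow> 0" by (rule lim_const_over_n)
    qed
    from tendsto_add[OF this \<tau>] show ?thesis by simp
  qed
  then show ?thesis by blast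
qed

end

section \<open>Irrational rotation number: orbits ordered as for the rotation\<close>

locale irrational_circle_lift = circle_lift +
  fixes \<alpha> :: real
  assumes rotation_limit: "(\<lambda>n. (F ^^ n) t / real n) \<longlonglongrightarrow> \<alpha>"
    and irrational: "\<alpha> \<notin> \<rat>"
begin

text \<open>The lift \<open>\<lambda>x. (F ^^ k) x + of_int m\<close> has translation number
  \<open>k * \<alpha> + m\<close>; its \<open>j\<close>-th iterate is the numerator.\<close>

lemma rotation_limit_multiple:
  assumes "k > 0"
  shows "(\<lambda>j. ((F ^^ (k * j)) x + of_int (int j * m)) / real j) \<longlonglongrightarrow> real k * \<alpha> + of_int m"
proof -
  have "strict_mono (\<lambda>j. k * j)" using assms by (auto simp: strict_mono_def)
  from LIMSEQ_subseq_LIMSEQ[OF rotation_limit[of x] this]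
  have "(\<lambda>j. real k * ((F ^^ (k * j)) x / real (k * j)) + of_int m) \<longlonglongrightarrow> real k * \<alpha> + of_int m"
    by (intro tendsto_intros) (simp add: o_def)
  then show ?thesis
    by (rule Lim_transform_eventually)
      (use assms in \<open>auto intro!: eventually_sequentiallyI[of 1] simp: field_simps\<close>)
qed

lemma iter_multiple:
  "(F ^^ (k * Suc j)) x + of_int (int (Suc j) * m)
     = (F ^^ k) ((F ^^ (k * j)) x + of_int (int j * m)) + of_int m"
  unfolding iter_shift_int by (simp add: funpow_add algebra_simps)

text \<open>If the lift \<open>F ^^ k + m\<close> failed to move one point \<open>x\<close> to the
  right, monotonicity would keep all its iterates at or below \<open>x\<close>, and its translation
  number would not be positive.\<close>

lemma iter_gt:
  assumes "real k * \<alpha> + of_int m > 0"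
  shows "(F ^^ k) x + of_int m > x"
proof (cases "k = 0")
  case False
  show ?thesis
  proof (rule ccontr)
    assume "\<not> ?thesis"
    then have le: "(F ^^ k) x + of_int m \<le> x" by simp
    have "(F ^^ (k * j)) x + of_int (int j * m) \<le> x" for j
    proof (induction j)
      case (Suc j)
      then have "(F ^^ k) ((F ^^ (k * j)) x + of_int (int j * m)) \<le> (F ^^ k) x" unfolding iter_le_iff .
      then show ?case unfolding iter_multiple using le by linarith
    qed simp
    then have "((F ^^ (k * j)) x + of_int (int j * m)) / real j \<le> x / real j" for j
      by (intro divide_right_mono) auto
    then have "real k * \<alpha> + of_int m \<le> 0"
      using False by (intro LIMSEQ_le[OF rotation_limit_multiple lim_const_over_n]) auto
    then show False using assms by simp
  qed
qed (use assms in simp)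

lemma iter_lt:
  assumes "real k * \<alpha> + of_int m < 0"
  shows "(F ^^ k) x + of_int m < x"
proof (cases "k = 0")
  case False
  show ?thesis
  proof (rule ccontr)
    assume "\<not> ?thesis"
    then have le: "x \<le> (F ^^ k) x + of_int m" by simp
    have "x \<le> (F ^^ (k * j)) x + of_int (int j * m)" for j
    proof (induction j)
      case (Suc j)
      then have "(F ^^ k) x \<le> (F ^^ k) ((F ^^ (k * j)) x + of_int (int j * m))" unfolding iter_le_iff .
      then show ?case unfolding iter_multiple using le by linarith
    qed simp
    then have "x / real j \<le> ((F ^^ (k * j)) x + of_int (int j * m)) / real j" for j
      by (intro divide_right_mono) auto
    then have "0 \<le> real k * \<alpha> + of_int m"
      using False by (intro LIMSEQ_le[OF lim_const_over_n rotation_limit_multiple]) auto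
    then show False using assms by simp
  qed
qed (use assms in simp)

text \<open>Cancelling the smaller number of iterates reduces the comparison to the displacement of
  a single orbit point.\<close>

lemma orbit_order:
  assumes "real n * \<alpha> + of_int m < real n' * \<alpha> + of_int m'"
  shows "(F ^^ n) x + of_int m < (F ^^ n') x + of_int m'"
proof (cases "n \<le> n'")
  case True
  define k where "k = n' - n"
  have n': "n' = k + n" using True by (simp add: k_def)
  have "real k * \<alpha> + of_int (m' - m) > 0" using assms by (simp add: n' algebra_simps)
  from iter_gt[OF this, of "(F ^^ n) x"] show ?thesis by (simp add: n' funpow_add)
next
  case False
  define k where "k = n - n'"
  have n: "n = k + n'" using False by (simp add: k_def)
  have "real k * \<alpha> + of_int (m - m') < 0" using assms by (simp add: n algebra_simps)
  from iter_lt[OF this, of "(F ^^ n') x"] show ?thesis by (simp add: n funpow_add)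
qed

text \<open>The interval from \<open>x\<close> to \<open>(F ^^ s) x + m\<close> is a fundamental cell of the order \<open>q\<close> dynamics: its
  first \<open>q\<close> iterates cover the circle, with multiplicity at most 7.\<close>

definition cell_step :: "nat \<Rightarrow> nat \<Rightarrow> int \<Rightarrow> bool" where
  "cell_step q s m \<longleftrightarrow> q > 0 \<and> 1 / real q < real s * \<alpha> + of_int m \<and>
     (\<forall>x v w. mono v \<longrightarrow> (\<forall>t :: real. v (t + 1) = v t + (w :: real)) \<longrightarrow>
       w \<le> (\<Sum>i<q. v ((F ^^ i) ((F ^^ s) x + of_int m)) - v ((F ^^ i) x)) \<and>
       (\<Sum>i<q. v ((F ^^ i) ((F ^^ s) x + of_int m)) - v ((F ^^ i) x)) \<le> 7 * w)"

text \<open>The cell ends at the orbit point of index 4. Every index is known up to an error below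
  1, so the cell has angle between \<open>3 / q\<close> and \<open>5 / q\<close>; its image at the
  point of index \<open>j\<close> ends after that of index \<open>j + 1\<close>, since
  \<open>j + 2 = (j - 1) + 3\<close>, and before that of index \<open>j + 7\<close>, since
  \<open>(j + 1) + 5 = (j + 7) - 1\<close>. Summing over a window of \<open>q\<close> indices gives
  the factors 1 and 7.\<close>

theorem exists_cell_step:
  assumes "good_approx \<alpha> p q"
  shows "\<exists>s m. cell_step q s m"
proof -
  obtain ii :: "int \<Rightarrow> nat" and mm :: "int \<Rightarrow> int" where lt: "\<And>j. ii j < q"
    and close: "\<And>j. \<bar>real (ii j) * \<alpha> + of_int (mm j) - of_int j / real q\<bar> < 1 / real q"
    and per: "\<And>j. ii (j + int q) = ii j" "\<And>j. mm (j + int q) = mm j + 1"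
    and bij: "\<And>k. bij_betw (\<lambda>i. ii (k + int i)) {..<q} {..<q}"
    by (rule rational_rotation_order[OF assms]) blast
  have q: "q > 0" using assms by (simp add: good_approx_def)
  have lower: "(of_int j - 1) / real q < real (ii j) * \<alpha> + of_int (mm j)" for j
    using close[of j] unfolding abs_less_iff diff_divide_distrib by linarith
  have upper: "real (ii j) * \<alpha> + of_int (mm j) < (of_int j + 1) / real q" for j
    using close[of j] unfolding abs_less_iff add_divide_distrib by linarith
  define s where "s = ii 4"
  define m where "m = mm 4"
  have sm: "3 / real q < real s * \<alpha> + of_int m" "real s * \<alpha> + of_int m < 5 / real q"
    using lower[of 4] upper[of 4] by (simp_all add: s_def m_def)
  define P where "P x j = (F ^^ ii j) x + of_int (mm j)" for x j
  have between: "P x (j + 1) \<le> (F ^^ ii j) ((F ^^ s) x + of_int m) + of_int (mm j)"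
    "(F ^^ ii j) ((F ^^ s) x + of_int m) + of_int (mm j) \<le> P x (j + 7)" for x j
  proof -
    have eq: "(F ^^ ii j) ((F ^^ s) x + of_int m) + of_int (mm j)
      = (F ^^ (ii j + s)) x + of_int (mm j + m)" by (simp add: funpow_add)
    have "real (ii (j + 1)) * \<alpha> + of_int (mm (j + 1)) < (of_int j - 1) / real q + 3 / real q"
      using upper[of "j + 1"] by (simp add: add_divide_distrib[symmetric])
    also have "\<dots> < real (ii j + s) * \<alpha> + of_int (mm j + m)"
      using lower[of j] sm(1) by (simp add: algebra_simps)
    finally show "P x (j + 1) \<le> (F ^^ ii j) ((F ^^ s) x + of_int m) + of_int (mm j)"
      unfolding eq P_def by (intro less_imp_le orbit_order)
    have "real (ii j + s) * \<alpha> + of_int (mm j + m) < (of_int j + 1) / real q + 5 / real q"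
      using upper[of j] sm(2) by (simp add: algebra_simps)
    also have "\<dots> < real (ii (j + 7)) * \<alpha> + of_int (mm (j + 7))"
      using lower[of "j + 7"] by (simp add: add_divide_distrib[symmetric])
    finally show "(F ^^ ii j) ((F ^^ s) x + of_int m) + of_int (mm j) \<le> P x (j + 7)"
      unfolding eq P_def by (intro less_imp_le orbit_order)
  qed
  have sums: "w \<le> (\<Sum>i<q. v ((F ^^ i) ((F ^^ s) x + of_int m)) - v ((F ^^ i) x))"
    "(\<Sum>i<q. v ((F ^^ i) ((F ^^ s) x + of_int m)) - v ((F ^^ i) x)) \<le> 7 * w"
    if v: "mono v" "\<And>t. v (t + 1) = v t + w" for x :: real and v :: "real \<Rightarrow> real" and w :: real
  proof -
    define h where "h j = v (P x j)" for j
    have h: "h (j + int q) = h j + w" for j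
      using v(2)[of "P x j"] by (simp add: h_def P_def per algebra_simps)
    have window: "(\<Sum>i<q. h (int i + k) - h (int i)) = of_int k * w" for k
      using window_sum_shift[of h q w k] h by (simp add: sum_subtractf add.commute)
    have "(\<Sum>i<q. v ((F ^^ i) ((F ^^ s) x + of_int m)) - v ((F ^^ i) x))
      = (\<Sum>i<q. v ((F ^^ ii (0 + int i)) ((F ^^ s) x + of_int m)) - v ((F ^^ ii (0 + int i)) x))"
      by (rule sum.reindex_bij_betw[OF bij, symmetric])
    also have "\<dots> = (\<Sum>i<q. v ((F ^^ ii (int i)) ((F ^^ s) x + of_int m) + of_int (mm (int i))) - h (int i))"
      by (simp add: h_def P_def degree_shift_int[of v w, OF v(2)])
    finally have eq: "(\<Sum>i<q. v ((F ^^ i) ((F ^^ s) x + of_int m)) - v ((F ^^ i) x))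
      = (\<Sum>i<q. v ((F ^^ ii (int i)) ((F ^^ s) x + of_int m) + of_int (mm (int i))) - h (int i))" .
    have "(\<Sum>i<q. h (int i + 1) - h (int i))
        \<le> (\<Sum>i<q. v ((F ^^ ii (int i)) ((F ^^ s) x + of_int m) + of_int (mm (int i))) - h (int i))"
      using between(1) by (intro sum_mono diff_right_mono) (simp add: h_def monoD[OF v(1)])
    then show "w \<le> (\<Sum>i<q. v ((F ^^ i) ((F ^^ s) x + of_int m)) - v ((F ^^ i) x))"
      unfolding eq window by simp
    have "(\<Sum>i<q. v ((F ^^ ii (int i)) ((F ^^ s) x + of_int m) + of_int (mm (int i))) - h (int i))
        \<le> (\<Sum>i<q. h (int i + 7) - h (int i))"
      using between(2) by (intro sum_mono diff_right_mono) (simp add: h_def monoD[OF v(1)])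
    then show "(\<Sum>i<q. v ((F ^^ i) ((F ^^ s) x + of_int m)) - v ((F ^^ i) x)) \<le> 7 * w"
      unfolding eq window by simp
  qed
  have "1 / real q < 3 / real q" using q by (intro divide_strict_right_mono) auto
  then have "cell_step q s m"
    unfolding cell_step_def using sums sm(1) q by force
  then show ?thesis by blast
qed

text \<open>Up to an integer, \<open>y\<close> lies between the points of index \<open>k\<close> and
  \<open>k + 1\<close> of the orbit of \<open>x\<close>. Adding the index errors, the
  \<open>j\<close>-th point of the orbit of \<open>y\<close> and the point of index
  \<open>j + k\<close> both lie between those of index \<open>j + k - 3\<close> and
  \<open>j + k + 4\<close>; windows of width 7 add up to \<open>7 * w\<close>.\<close>

theorem denjoy_koksma:
  assumes appr: "good_approx \<alpha> p q" and var: "variation_le r w" and rper: "\<And>t. r (t + 1) = r t"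
  shows "\<bar>(\<Sum>i<q. r ((F ^^ i) y)) - (\<Sum>i<q. r ((F ^^ i) x))\<bar> \<le> 7 * w"
proof -
  obtain ii :: "int \<Rightarrow> nat" and mm :: "int \<Rightarrow> int" where lt: "\<And>j. ii j < q"
    and close: "\<And>j. \<bar>real (ii j) * \<alpha> + of_int (mm j) - of_int j / real q\<bar> < 1 / real q"
    and per: "\<And>j. ii (j + int q) = ii j" "\<And>j. mm (j + int q) = mm j + 1" and zero: "ii 0 = 0" "mm 0 = 0"
    and bij: "\<And>k. bij_betw (\<lambda>i. ii (k + int i)) {..<q} {..<q}"
    by (rule rational_rotation_order[OF appr]) blast
  have q: "q > 0" using appr by (simp add: good_approx_def)
  have lower: "(of_int j - 1) / real q < real (ii j) * \<alpha> + of_int (mm j)" for j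
    using close[of j] unfolding abs_less_iff diff_divide_distrib by linarith
  have upper: "real (ii j) * \<alpha> + of_int (mm j) < (of_int j + 1) / real q" for j
    using close[of j] unfolding abs_less_iff add_divide_distrib by linarith
  obtain v where v: "mono v" "\<And>t. v (t + 1) = v t + w"
    "\<And>s t. s \<le> t \<Longrightarrow> \<bar>r t - r s\<bar> \<le> v t - v s"
    by (rule variation_leE[OF var]) blast
  define P where "P j = (F ^^ ii j) x + of_int (mm j)" for j
  define z where "z = y + of_int (- \<lfloor>y - x\<rfloor>)"
  have z: "x \<le> z" "z < x + 1" unfolding z_def by linarith+
  have zsum: "(\<Sum>i<q. r ((F ^^ i) y)) = (\<Sum>i<q. r ((F ^^ i) z))"
    unfolding z_def iter_shift_int by (simp only: periodic_shift_int[of r, OF rper])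
  have "P 0 = x" "P (0 + int q) = x + 1" using per[of 0] unfolding P_def by (simp_all add: zero)
  \<comment> \<open>The error bounds alone do not order points of adjacent index, so an index is
    chosen at which the sequence crosses \<open>z\<close>; it exists because \<open>P 0 = x\<close>
    and \<open>P q = x + 1\<close>.\<close>
  then obtain k0 :: nat where k0: "\<not> P (int k0) > z" "P (int (k0 + 1)) > z"
    using ex_least_nat_less[of "\<lambda>i. P (int i) > z" q] z by force
  define k where "k = int k0"
  have k: "P k \<le> z" "z < P (k + 1)" using k0 by (simp_all add: k_def algebra_simps)
  have near: "P (j + k - 3) \<le> (F ^^ ii j) z + of_int (mm j)" "P (j + k - 3) \<le> P (j + k)"
    "(F ^^ ii j) z + of_int (mm j) \<le> P (j + k + 4)" "P (j + k) \<le> P (j + k + 4)" for j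
  proof -
    have less: "P a < P b" if "a + 2 \<le> b" for a b
    proof -
      have "(of_int a + 1) / real q \<le> (of_int b - 1) / real q"
        using that by (intro divide_right_mono) linarith+
      then show ?thesis unfolding P_def using upper[of a] lower[of b] by (intro orbit_order) linarith
    qed
    show "P (j + k - 3) \<le> P (j + k)" "P (j + k) \<le> P (j + k + 4)" by (intro less_imp_le less; simp)+
    have comp: "(F ^^ ii j) (P l) + of_int (mm j) = (F ^^ (ii j + ii l)) x + of_int (mm j + mm l)" for l
      by (simp add: P_def funpow_add)
    have "real (ii (j + k - 3)) * \<alpha> + of_int (mm (j + k - 3)) < (of_int j - 1) / real q + (of_int k - 1) / real q"
      using upper[of "j + k - 3"] by (simp add: add_divide_distrib[symmetric])
    also have "\<dots> < real (ii j + ii k) * \<alpha> + of_int (mm j + mm k)"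
      using lower[of j] lower[of k] by (simp add: algebra_simps)
    finally have "P (j + k - 3) < (F ^^ ii j) (P k) + of_int (mm j)"
      unfolding comp P_def[of "j + k - 3"] by (rule orbit_order)
    also have "\<dots> \<le> (F ^^ ii j) z + of_int (mm j)" using k by simp
    finally show "P (j + k - 3) \<le> (F ^^ ii j) z + of_int (mm j)" by simp
    have "real (ii j + ii (k + 1)) * \<alpha> + of_int (mm j + mm (k + 1))
        < (of_int j + 1) / real q + (of_int (k + 1) + 1) / real q"
      using upper[of j] upper[of "k + 1"] by (simp add: algebra_simps)
    also have "\<dots> < real (ii (j + k + 4)) * \<alpha> + of_int (mm (j + k + 4))"
      using lower[of "j + k + 4"] by (simp add: add_divide_distrib[symmetric] algebra_simps)
    finally have "(F ^^ ii j) (P (k + 1)) + of_int (mm j) < P (j + k + 4)"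
      unfolding comp P_def[of "j + k + 4"] by (rule orbit_order)
    moreover have "(F ^^ ii j) z + of_int (mm j) \<le> (F ^^ ii j) (P (k + 1)) + of_int (mm j)" using k by simp
    ultimately show "(F ^^ ii j) z + of_int (mm j) \<le> P (j + k + 4)" by linarith
  qed
  define h where "h j = v (P j)" for j
  have h: "h (j + int q) = h j + w" for j
    using v(2)[of "P j"] by (simp add: h_def P_def per algebra_simps)
  have osc: "\<bar>r b - r a\<bar> \<le> v d - v c" if "c \<le> a" "a \<le> d" "c \<le> b" "b \<le> d" for a b c d
  proof (cases "a \<le> b")
    case True
    then show ?thesis using v(3)[of a b] monoD[OF v(1), of c a] monoD[OF v(1), of b d] that by linarith
  next
    case False
    then show ?thesis using v(3)[of b a] monoD[OF v(1), of c b] monoD[OF v(1), of a d] that by linarith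
  qed
  have "(\<Sum>i<q. r ((F ^^ i) x)) = (\<Sum>i<q. r ((F ^^ ii (k + int i)) x))"
    by (rule sum.reindex_bij_betw[OF bij, symmetric])
  also have "\<dots> = (\<Sum>i<q. r (P (int i + k)))"
    unfolding P_def periodic_shift_int[of r, OF rper] by (simp add: add.commute)
  finally have sx: "(\<Sum>i<q. r ((F ^^ i) x)) = (\<Sum>i<q. r (P (int i + k)))" .
  have "(\<Sum>i<q. r ((F ^^ i) z)) = (\<Sum>i<q. r ((F ^^ ii (0 + int i)) z))"
    by (rule sum.reindex_bij_betw[OF bij, symmetric])
  also have "\<dots> = (\<Sum>i<q. r ((F ^^ ii (int i)) z + of_int (mm (int i))))"
    by (simp add: periodic_shift_int[of r, OF rper])
  finally have sz: "(\<Sum>i<q. r ((F ^^ i) z)) = (\<Sum>i<q. r ((F ^^ ii (int i)) z + of_int (mm (int i))))" .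
  have "\<bar>(\<Sum>i<q. r ((F ^^ i) y)) - (\<Sum>i<q. r ((F ^^ i) x))\<bar>
      = \<bar>\<Sum>i<q. r ((F ^^ ii (int i)) z + of_int (mm (int i))) - r (P (int i + k))\<bar>"
    unfolding zsum sz sx sum_subtractf ..
  also have "\<dots> \<le> (\<Sum>i<q. \<bar>r ((F ^^ ii (int i)) z + of_int (mm (int i))) - r (P (int i + k))\<bar>)"
    by (rule sum_abs)
  also have "\<dots> \<le> (\<Sum>i<q. h (int i + k + 4) - h (int i + k - 3))"
    unfolding h_def by (intro sum_mono osc near)
  also have "\<dots> = (\<Sum>i<q. h (k + 4 + int i)) - (\<Sum>i<q. h (k - 3 + int i))"
    unfolding sum_subtractf by (simp add: algebra_simps)
  also have "\<dots> = 7 * w"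
    unfolding window_sum_shift[of h q w, OF h] by (simp add: algebra_simps)
  finally show ?thesis .
qed

end

section \<open>Bounded distortion and visits to arcs\<close>

text \<open>An interval of length at most \<open>\<eta>\<close> that meets the arc trimmed by \<open>\<eta>\<close> on both sides lies inside the
  arc, so no intervals straddling an end point have to be accounted for.\<close>

lemma arc_length_trimmed:
  assumes ab: "0 \<le> a" "b \<le> 1" "0 < \<eta>" "a + \<eta> \<le> b - \<eta>" and uv: "u \<le> v'" "v' \<le> v" "v - u \<le> \<eta>"
  shows "(v' - u) * (arc_length (a + \<eta>) (b - \<eta>) v - arc_length (a + \<eta>) (b - \<eta>) u)
    \<le> (v - u) * (arc_length a b v' - arc_length a b u)"
proof -
  define n where "n = \<lfloor>u\<rfloor>"
  have n: "of_int n \<le> u" "u < of_int n + 1" unfolding n_def by linarith+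
  have ab0: "0 \<le> a + \<eta>" "a + \<eta> \<le> b - \<eta>" "b - \<eta> \<le> 1" using ab by auto
  note on0 = arc_length_on[OF ab0, of n] and on1 = arc_length_on[OF ab0, of "n + 1"]
  show ?thesis
  proof (cases "of_int n + a \<le> u \<and> u \<le> of_int n + (b - \<eta>)")
    case True
    then have cell: "v \<le> of_int n + b" "v \<le> of_int n + 1" using uv ab by linarith+
    have "arc_length a b v' - arc_length a b u = v' - u"
      by (rule arc_length_diff_cell[of _ _ n]) (use True cell uv ab in linarith)+
    moreover have "arc_length (a + \<eta>) (b - \<eta>) v - arc_length (a + \<eta>) (b - \<eta>) u \<le> v - u"
      using on0[of u] on0[of v] n cell uv by (auto simp: max_def min_def)
    then have "(v' - u) * (arc_length (a + \<eta>) (b - \<eta>) v - arc_length (a + \<eta>) (b - \<eta>) u)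
        \<le> (v' - u) * (v - u)" using uv by (intro mult_left_mono) auto
    ultimately show ?thesis by (simp add: mult.commute)
  next
    case False
    have "arc_length (a + \<eta>) (b - \<eta>) v = arc_length (a + \<eta>) (b - \<eta>) u"
    proof (cases "u < of_int n + a")
      case True
      then show ?thesis using on0[of u] on0[of v] n uv ab by (auto simp: max_def min_def)
    next
      case above: False
      then have "u > of_int n + (b - \<eta>)" using False by auto
      then have u: "arc_length (a + \<eta>) (b - \<eta>) u = of_int (n + 1) * (b - \<eta> - (a + \<eta>))"
        using on0[of u] n ab0 by (auto simp: max_def min_def algebra_simps)
      show ?thesis
      proof (cases "v \<le> of_int n + 1")
        case True
        then show ?thesis
          using on0[of v] u n uv \<open>u > of_int n + (b - \<eta>)\<close> ab0 by (auto simp: max_def min_def algebra_simps)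
      next
        case False
        then have "of_int (n + 1) \<le> v" "v \<le> of_int (n + 1) + 1" "v - of_int (n + 1) \<le> a + \<eta>"
          using n uv ab by auto
        then show ?thesis using on1[of v] u ab0 by (auto simp: max_def min_def)
      qed
    qed
    moreover have "arc_length a b u \<le> arc_length a b v'"
      using mono_arc_length[of a b] uv ab by (auto dest: monoD)
    ultimately show ?thesis using uv by (simp add: mult_nonneg_nonneg)
  qed
qed

section \<open>Lipschitz functions and periodic continuous functions\<close>

lemma arc_length_diff_le:
  assumes ab: "0 \<le> a" "a \<le> b" "b \<le> 1" and st: "s \<le> t"
  shows "arc_length a b t - arc_length a b s \<le> t - s"
proof -
  have unit: "arc_length a b t - arc_length a b s \<le> t - s"
    if "of_int n \<le> s" "s \<le> t" "t \<le> of_int n + 1" for n s t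
    using arc_length_on[OF ab, of n s] arc_length_on[OF ab, of n t] that ab by (auto simp: max_def min_def)
  have int: "arc_length a b (of_int k) = of_int k * (b - a)" for k
    using ab by (simp add: arc_length_def)
  define m where "m = \<lfloor>s\<rfloor>"
  define n where "n = \<lfloor>t\<rfloor>"
  have m: "of_int m \<le> s" "s \<le> of_int m + 1" and n: "of_int n \<le> t" "t \<le> of_int n + 1"
    unfolding m_def n_def by linarith+
  show ?thesis
  proof (cases "m = n")
    case True
    then show ?thesis using unit[of m s t] m n st by simp
  next
    case False
    then have "m + 1 \<le> n" using floor_mono[OF st] by (simp add: m_def n_def)
    then have "of_int (n - (m + 1)) * (b - a) \<le> of_int (n - (m + 1)) * (1 :: real)"
      using ab by (intro mult_left_mono) auto
    then have "arc_length a b (of_int n) - arc_length a b (of_int (m + 1)) \<le> of_int n - of_int (m + 1)"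
      unfolding int by (simp add: algebra_simps)
    then show ?thesis using unit[of m s "of_int (m + 1)"] unit[of n "of_int n" t] m n by simp
  qed
qed

lemma lipschitz_arc_length:
  assumes ab: "0 \<le> a" "a \<le> b" "b \<le> 1"
  shows "1-lipschitz_on UNIV (arc_length a b)"
proof (rule lipschitz_onI)
  fix s t :: real
  have *: "\<bar>arc_length a b t - arc_length a b s\<bar> \<le> t - s" if "s \<le> t" for s t
    using arc_length_diff_le[OF ab that] monoD[OF mono_arc_length[OF ab] that] by simp
  show "dist (arc_length a b s) (arc_length a b t) \<le> 1 * dist s t"
    using *[of s t] *[of t s] by (cases "s \<le> t") (auto simp: dist_real_def abs_minus_commute)
qed simp

lemma lipschitz_sum_cmult:
  fixes h :: "'i \<Rightarrow> real \<Rightarrow> real"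
  assumes "finite A" "\<And>i. i \<in> A \<Longrightarrow> \<exists>C. C-lipschitz_on UNIV (h i)"
  shows "\<exists>C. C-lipschitz_on UNIV (\<lambda>x. \<Sum>i\<in>A. k i * h i x)"
  using assms
proof (induction A rule: finite_induct)
  case empty
  show ?case by (auto intro!: exI[of _ 0] lipschitz_onI)
next
  case (insert i A)
  obtain C where C: "C-lipschitz_on UNIV (\<lambda>x. \<Sum>i\<in>A. k i * h i x)" using insert by auto
  obtain D where "D-lipschitz_on UNIV (h i)" using insert by auto
  from lipschitz_on_add[OF lipschitz_on_cmult_real[OF this, of "k i"] C]
  show ?case using insert by auto
qed

lemma lipschitz_interpolant: "\<exists>C. C-lipschitz_on UNIV (interpolant g M)"
  unfolding interpolant_def
  by (intro lipschitz_sum_cmult exI[of _ 1] lipschitz_arc_length) (auto simp: field_simps)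

lemma lipschitz_absolutely_continuous:
  fixes r :: "real \<Rightarrow> real"
  assumes "C-lipschitz_on UNIV r"
  shows "absolutely_continuous_on a b r"
  unfolding absolutely_continuous_on_def
proof (intro allI impI)
  fix e :: real assume e: "e > 0"
  have C: "C \<ge> 0" using assms by (rule lipschitz_on_nonneg)
  show "\<exists>\<delta>>0. \<forall>(n::nat) u v. (\<forall>i<n. a \<le> u i \<and> u i \<le> v i \<and> v i \<le> b) \<and>
      disjoint_family_on (\<lambda>i. {u i<..<v i}) {..<n} \<and> (\<Sum>i<n. v i - u i) < \<delta> \<longrightarrow>
      (\<Sum>i<n. \<bar>r (v i) - r (u i)\<bar>) < e"
  proof (intro exI[of _ "e / (C + 1)"] conjI allI impI)
    fix n :: nat and u v :: "nat \<Rightarrow> real"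
    assume *: "(\<forall>i<n. a \<le> u i \<and> u i \<le> v i \<and> v i \<le> b) \<and>
      disjoint_family_on (\<lambda>i. {u i<..<v i}) {..<n} \<and> (\<Sum>i<n. v i - u i) < e / (C + 1)"
    have "(\<Sum>i<n. \<bar>r (v i) - r (u i)\<bar>) \<le> (\<Sum>i<n. (C + 1) * (v i - u i))"
    proof (rule sum_mono)
      fix i assume "i \<in> {..<n}"
      then have "u i \<le> v i" using * by auto
      then show "\<bar>r (v i) - r (u i)\<bar> \<le> (C + 1) * (v i - u i)"
        using lipschitz_onD[OF assms, of "v i" "u i"] C by (simp add: dist_real_def algebra_simps)
    qed
    also have "\<dots> = (\<Sum>i<n. v i - u i) * (C + 1)" by (simp add: mult.commute flip: sum_distrib_left)
    also have "\<dots> < e" using * C by (simp add: pos_less_divide_eq[symmetric])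
    finally show "(\<Sum>i<n. \<bar>r (v i) - r (u i)\<bar>) < e" .
  qed (use e C in auto)
qed

lemma periodic_uniformly_continuous:
  fixes \<psi> :: "real \<Rightarrow> real"
  assumes cont: "continuous_on UNIV \<psi>" and per: "\<And>t. \<psi> (t + 1) = \<psi> t" and e: "e > 0"
  obtains d where "d > 0" "\<And>x y. \<bar>x - y\<bar> < d \<Longrightarrow> \<bar>\<psi> x - \<psi> y\<bar> < e"
proof -
  have "uniformly_continuous_on {-1..2} \<psi>"
    using cont by (intro compact_uniformly_continuous continuous_on_subset[OF cont]) auto
  then obtain d where d: "d > 0" "\<And>x y. x \<in> {-1..2} \<Longrightarrow> y \<in> {-1..2} \<Longrightarrow> dist y x < d \<Longrightarrow> dist (\<psi> y) (\<psi> x) < e"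
    using e unfolding uniformly_continuous_on_def by metis
  show thesis
  proof (rule that[of "min d 1"])
    fix x y :: real assume xy: "\<bar>x - y\<bar> < min d 1"
    define k where "k = - \<lfloor>x\<rfloor>"
    have "0 \<le> x + of_int k" "x + of_int k \<le> 1" unfolding k_def by linarith+
    then have "dist (\<psi> (x + of_int k)) (\<psi> (y + of_int k)) < e"
      using xy by (intro d(2)) (auto simp: dist_real_def)
    then show "\<bar>\<psi> x - \<psi> y\<bar> < e"
      unfolding periodic_shift_int[of \<psi>, OF per] by (simp add: dist_real_def)
  qed (use d in auto)
qed

section \<open>Lifts whose logarithmic derivative has bounded variation\<close>

locale denjoy_lift = irrational_circle_lift +
  fixes g :: "real \<Rightarrow> real" and V :: real
  assumes lift_deriv: "(F has_real_derivative exp (g t)) (at t)"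
    and g_cont: "continuous_on UNIV g" and g_per: "g (t + 1) = g t" and g_var: "variation_le g V"
begin

lemma V_nonneg: "V \<ge> 0" using g_var by (rule variation_le_nonneg)

lemma iter_cont: "continuous_on A (F ^^ n)"
proof (induction n arbitrary: A)
  case (Suc n)
  have "continuous_on UNIV F" using lift_deriv by (auto intro!: DERIV_continuous_on)
  then show ?case unfolding funpow.simps o_def
    by (rule continuous_on_compose2) (use Suc in \<open>auto simp: o_def\<close>)
qed (simp add: id_def)

definition birkhoff :: "nat \<Rightarrow> (real \<Rightarrow> real) \<Rightarrow> real \<Rightarrow> real" where
  "birkhoff n r x = (\<Sum>i<n. r ((F ^^ i) x))"

lemma iter_deriv: "((F ^^ n) has_real_derivative exp (birkhoff n g t)) (at t)"
proof (induction n)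
  case 0
  then show ?case by (simp add: birkhoff_def id_def)
next
  case (Suc n)
  from DERIV_chain[OF lift_deriv Suc] show ?case
    by (simp add: birkhoff_def exp_add mult.commute o_def)
qed

lemma iter_mvt:
  assumes "x < y"
  obtains z where "x < z" "z < y" "(F ^^ n) y - (F ^^ n) x = (y - x) * exp (birkhoff n g z)"
  using MVT2[OF assms, of "F ^^ n" "\<lambda>t. exp (birkhoff n g t)"] iter_deriv by blast

text \<open>An iterate gains exactly 1 over a period, so the mean value theorem yields a point with
  derivative 1.\<close>

lemma birkhoff_zero: "\<exists>y. birkhoff n g y = 0"
proof -
  obtain z where "(F ^^ n) 1 - (F ^^ n) 0 = (1 - 0) * exp (birkhoff n g z)"
    using iter_mvt[of 0 1 n] by auto
  moreover have "(F ^^ n) 1 = (F ^^ n) 0 + 1" using iter_shift[of n 0] by simp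
  ultimately have "exp (birkhoff n g z) = 1" by simp
  then show ?thesis by auto
qed

lemma denjoy:
  assumes "good_approx \<alpha> p q"
  shows "\<bar>birkhoff q g x\<bar> \<le> 7 * V"
proof -
  obtain y where "birkhoff q g y = 0" using birkhoff_zero by blast
  then show ?thesis
    using denjoy_koksma[OF assms g_var g_per, of x y] by (simp add: birkhoff_def)
qed

lemma expansion_ge:
  assumes "good_approx \<alpha> p q" "x \<le> y"
  shows "exp (- (7 * V)) * (y - x) \<le> (F ^^ q) y - (F ^^ q) x"
proof (cases "x = y")
  case False
  then obtain z where z: "(F ^^ q) y - (F ^^ q) x = (y - x) * exp (birkhoff q g z)"
    using iter_mvt[of x y q] assms by fastforce
  have "exp (- (7 * V)) \<le> exp (birkhoff q g z)" using denjoy[OF assms(1), of z] by simp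
  then have "exp (- (7 * V)) * (y - x) \<le> exp (birkhoff q g z) * (y - x)"
    using assms by (intro mult_right_mono) auto
  then show ?thesis unfolding z by (simp add: mult.commute)
qed simp

abbreviation cell_end :: "nat \<Rightarrow> int \<Rightarrow> real \<Rightarrow> real" where
  "cell_end s m x \<equiv> (F ^^ s) x + of_int m"

lemma cell_sum_le:
  fixes v :: "real \<Rightarrow> real"
  assumes "cell_step q s m" "mono v" "\<And>t. v (t + 1) = v t + w"
  shows "(\<Sum>i<q. v ((F ^^ i) (cell_end s m x)) - v ((F ^^ i) x)) \<le> 7 * w"
  using assms unfolding cell_step_def by blast

lemma cell_sum_ge:
  fixes v :: "real \<Rightarrow> real"
  assumes "cell_step q s m" "mono v" "\<And>t. v (t + 1) = v t + w"
  shows "w \<le> (\<Sum>i<q. v ((F ^^ i) (cell_end s m x)) - v ((F ^^ i) x))"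
  using assms unfolding cell_step_def by blast

lemma cell_end_gt:
  assumes "cell_step q s m"
  shows "x < cell_end s m x"
proof (rule iter_gt)
  have "0 \<le> 1 / real q" by simp
  then show "0 < real s * \<alpha> + of_int m" using assms unfolding cell_step_def by linarith
qed

lemma iter_cell_end: "(F ^^ i) (cell_end s m x) = cell_end s m ((F ^^ i) x)"
  unfolding iter_shift_int by (metis add.commute comp_apply funpow_add)

text \<open>For \<open>a \<in> A\<close> the image of the cell keeps at least the fraction
  \<open>exp (- (7 * V))\<close> of its length by Denjoy's inequality, while the first
  \<open>q\<close> images have total length at most 7.\<close>

lemma cell_length_le:
  assumes step: "cell_step q s m" and A: "finite A" "\<And>a. a \<in> A \<Longrightarrow> a < q \<and> (\<exists>p. good_approx \<alpha> p a)"
  shows "real (card A) * (exp (- (7 * V)) * (cell_end s m x - x)) \<le> 7"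
proof -
  have gt: "x \<le> cell_end s m x" using cell_end_gt[OF step] by (rule less_imp_le)
  have "real (card A) * (exp (- (7 * V)) * (cell_end s m x - x))
      = (\<Sum>a\<in>A. exp (- (7 * V)) * (cell_end s m x - x))" by simp
  also have "\<dots> \<le> (\<Sum>a\<in>A. (F ^^ a) (cell_end s m x) - (F ^^ a) x)"
    using A(2) expansion_ge[OF _ gt] by (intro sum_mono) blast
  also have "\<dots> \<le> (\<Sum>a<q. (F ^^ a) (cell_end s m x) - (F ^^ a) x)"
  proof (rule sum_mono2)
    fix a
    show "0 \<le> (F ^^ a) (cell_end s m x) - (F ^^ a) x" using gt unfolding diff_ge_0_iff_ge iter_le_iff .
  qed (use A in auto)
  also have "\<dots> \<le> 7" using cell_sum_le[OF step, of "\<lambda>t. t" 1 x] by (auto intro: monoI)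
  finally show ?thesis .
qed

abbreviation den :: "nat \<Rightarrow> nat" where
  "den \<equiv> convergent_denom \<alpha>"

lemma good_approx_den: "good_approx \<alpha> (convergent_num \<alpha> n) (den n)"
  by (rule convergent_good_approx[OF irrational])

text \<open>This takes the place of the absence of wandering intervals in Denjoy's theorem. The
  \<open>n - 1\<close> distinct denominators \<open>den 1\<close>, ..., \<open>den (n - 1)\<close>
  lie below \<open>den n\<close>, so cells have length at most
  \<open>7 * exp (7 * V) / (n - 1)\<close>.\<close>

lemma mesh_tendsto_0:
  assumes \<eta>: "\<eta> > 0"
  shows "\<exists>N. \<forall>n\<ge>N. \<forall>s m x. cell_step (den n) s m \<longrightarrow> cell_end s m x - x \<le> \<eta>"
proof -
  obtain N :: nat where N: "7 * exp (7 * V) / \<eta> < real N" using reals_Archimedean2 by blast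
  have Npos: "real N > 0" using N \<eta> by (smt (verit) divide_pos_pos exp_gt_zero mult_pos_pos)
  have "cell_end s m x - x \<le> \<eta>" if n: "n \<ge> Suc N" and step: "cell_step (den n) s m" for n s m x
  proof -
    define A where "A = (\<lambda>k. den (Suc k)) ` {..<n - 1}"
    have mono: "strict_mono (\<lambda>k. den (Suc k))" by (rule strict_mono_convergent_denom[OF irrational])
    have "card A = n - 1"
      unfolding A_def by (subst card_image) (auto intro!: inj_on_subset[OF strict_mono_imp_inj_on[OF mono]])
    moreover have "a < den n \<and> (\<exists>p. good_approx \<alpha> p a)" if aA: "a \<in> A" for a
    proof -
      obtain k where k: "a = den (Suc k)" "k < n - 1" using aA by (auto simp: A_def)
      then show ?thesis using strict_monoD[OF mono, of k "n - 1"] good_approx_den n by auto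
    qed
    ultimately have "real (n - 1) * (exp (- (7 * V)) * (cell_end s m x - x)) \<le> 7"
      using cell_length_le[OF step, of A x] by (auto simp: A_def)
    moreover have "real N * (exp (- (7 * V)) * (cell_end s m x - x))
        \<le> real (n - 1) * (exp (- (7 * V)) * (cell_end s m x - x))"
      using n cell_end_gt[OF step, of x] by (intro mult_right_mono mult_nonneg_nonneg) auto
    ultimately have "real N * (exp (- (7 * V)) * (cell_end s m x - x)) \<le> 7" by linarith
    then have "real N * (exp (- (7 * V)) * (cell_end s m x - x)) * exp (7 * V) \<le> 7 * exp (7 * V)"
      by (rule mult_right_mono) simp
    moreover have "real N * (exp (- (7 * V)) * (cell_end s m x - x)) * exp (7 * V)
        = real N * (cell_end s m x - x) * (exp (- (7 * V)) * exp (7 * V))" by (simp only: mult_ac)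
    moreover have "exp (- (7 * V)) * exp (7 * V) = 1" by (simp flip: exp_add)
    ultimately have "real N * (cell_end s m x - x) \<le> 7 * exp (7 * V)" by simp
    also have "\<dots> < real N * \<eta>" using N \<eta> by (simp add: field_simps)
    finally show ?thesis using Npos by simp
  qed
  then show ?thesis by blast
qed

text \<open>The angle \<open>q * \<alpha> - p\<close> is smaller in modulus than the angle of a
  cell. Hence the image \<open>z\<close> of \<open>x\<close> precedes the end of the cell at
  \<open>x\<close>, and \<open>x\<close> precedes the end of the cell at \<open>z\<close>.\<close>

lemma displacement_le_mesh:
  assumes appr: "good_approx \<alpha> p q" and step: "cell_step q s m"
    and mesh: "\<And>x. cell_end s m x - x \<le> \<eta>"
  shows "\<bar>(F ^^ q) x + of_int (- p) - x\<bar> \<le> \<eta>"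
proof -
  have small: "\<bar>real q * \<alpha> - of_int p\<bar> < 1 / real q" "1 / real q < real s * \<alpha> + of_int m"
    using appr step by (auto simp: good_approx_def cell_step_def)
  define z where "z = (F ^^ q) x + of_int (- p)"
  have "z < cell_end s m x" unfolding z_def using small by (intro orbit_order) auto
  moreover have "(F ^^ 0) x + of_int 0 < (F ^^ (s + q)) x + of_int (m - p)"
    using small by (intro orbit_order) (auto simp: algebra_simps)
  then have "x < cell_end s m z" unfolding z_def iter_shift_int by (simp add: funpow_add)
  ultimately show ?thesis using mesh[of x] mesh[of z] unfolding z_def[symmetric] by linarith
qed

text \<open>The images of a cell overlap at most 7 times, so the oscillations of \<open>g\<close> on
  them add up to at most \<open>7 * V\<close>, uniformly in the number of iterates up to
  \<open>q\<close>.\<close>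

lemma distortion:
  assumes step: "cell_step q s m" and n: "n \<le> q"
    and z: "x \<le> z" "z \<le> cell_end s m x" and z': "x \<le> z'" "z' \<le> cell_end s m x"
  shows "birkhoff n g z \<le> birkhoff n g z' + 7 * V"
proof -
  obtain v where v: "mono v" "\<And>t. v (t + 1) = v t + V"
    "\<And>s t. s \<le> t \<Longrightarrow> \<bar>g t - g s\<bar> \<le> v t - v s"
    by (rule variation_leE[OF g_var]) blast
  have osc: "g b - g a \<le> v d - v c" if "c \<le> a" "a \<le> d" "c \<le> b" "b \<le> d" for a b c d
  proof (cases "a \<le> b")
    case True
    then show ?thesis using v(3)[of a b] monoD[OF v(1), of c a] monoD[OF v(1), of b d] that by linarith
  next
    case False
    then show ?thesis using v(3)[of b a] monoD[OF v(1), of c b] monoD[OF v(1), of a d] that by linarith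
  qed
  have "birkhoff n g z - birkhoff n g z' = (\<Sum>i<n. g ((F ^^ i) z) - g ((F ^^ i) z'))"
    by (simp add: birkhoff_def sum_subtractf)
  also have "\<dots> \<le> (\<Sum>i<n. v ((F ^^ i) (cell_end s m x)) - v ((F ^^ i) x))"
    using z z' by (intro sum_mono osc) (auto simp del: iter_shift_int)
  also have "\<dots> \<le> (\<Sum>i<q. v ((F ^^ i) (cell_end s m x)) - v ((F ^^ i) x))"
    using n z by (intro sum_mono2) (auto intro!: monoD[OF v(1)] simp del: iter_shift_int)
  also have "\<dots> \<le> 7 * V" by (rule cell_sum_le[OF step v(1,2)])
  finally show ?thesis by simp
qed

text \<open>Both increments are derivatives at points of one cell, by the mean value theorem. By
  bounded distortion the share of \<open>[x, y]\<close> in the cell changes under iteration by a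
  factor of at most \<open>exp (7 * V)\<close>; products stand for the quotients.\<close>

lemma cell_ratio:
  assumes step: "cell_step q s m" and n: "n \<le> q" and xy: "x < y" "y \<le> cell_end s m x"
  shows "((F ^^ n) (cell_end s m x) - (F ^^ n) x) * (y - x)
      \<le> exp (7 * V) * (((F ^^ n) y - (F ^^ n) x) * (cell_end s m x - x))"
    and "((F ^^ n) y - (F ^^ n) x) * (cell_end s m x - x)
      \<le> exp (7 * V) * (((F ^^ n) (cell_end s m x) - (F ^^ n) x) * (y - x))"
proof -
  let ?Y = "cell_end s m x"
  have xY: "x < ?Y" by (rule cell_end_gt[OF step])
  obtain z where z: "x < z" "z < y" "(F ^^ n) y - (F ^^ n) x = (y - x) * exp (birkhoff n g z)"
    using iter_mvt[OF xy(1)] by metis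
  obtain z' where z': "x < z'" "z' < ?Y" "(F ^^ n) ?Y - (F ^^ n) x = (?Y - x) * exp (birkhoff n g z')"
    using iter_mvt[OF xY] by metis
  have "birkhoff n g z \<le> birkhoff n g z' + 7 * V" "birkhoff n g z' \<le> birkhoff n g z + 7 * V"
    using z z' xy by (intro distortion[OF step n, of x]; linarith)+
  then have e: "exp (birkhoff n g z) \<le> exp (7 * V) * exp (birkhoff n g z')"
    "exp (birkhoff n g z') \<le> exp (7 * V) * exp (birkhoff n g z)"
    by (simp_all flip: exp_add add: add.commute)
  have pos: "0 \<le> (y - x) * (?Y - x)" using xy xY by (intro mult_nonneg_nonneg) auto
  show "((F ^^ n) ?Y - (F ^^ n) x) * (y - x) \<le> exp (7 * V) * (((F ^^ n) y - (F ^^ n) x) * (?Y - x))"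
    unfolding z(3) z'(3) using mult_right_mono[OF e(2) pos] by (simp add: mult_ac)
  show "((F ^^ n) y - (F ^^ n) x) * (?Y - x) \<le> exp (7 * V) * (((F ^^ n) ?Y - (F ^^ n) x) * (y - x))"
    unfolding z(3) z'(3) using mult_right_mono[OF e(1) pos] by (simp add: mult_ac)
qed

text \<open>Consecutive cells starting at \<open>x\<close> form a chain that passes every
  \<open>y\<close>, because each of them advances by a fixed positive angle.\<close>

lemma mono_if_mono_on_cells:
  assumes step: "cell_step q s m" and local: "\<And>x y. x \<le> y \<Longrightarrow> y \<le> cell_end s m x \<Longrightarrow> H x \<le> (H y :: real)"
  shows "mono H"
proof (rule monoI)
  fix x y :: real assume xy: "x \<le> y"
  define z where "z k = (F ^^ (s * k)) x + of_int (int k * m)" for k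
  have z0: "z 0 = x" by (simp add: z_def)
  have zSuc: "z (Suc k) = cell_end s m (z k)" for k unfolding z_def by (rule iter_multiple)
  have inc: "z k < z (Suc k)" for k unfolding zSuc by (rule cell_end_gt[OF step])
  have xz: "x \<le> z k" for k using lift_Suc_mono_le[of z 0 k] inc z0 by (auto intro: less_imp_le)
  have H: "\<forall>y. x \<le> y \<and> y \<le> z k \<longrightarrow> H x \<le> H y" for k
  proof (induction k)
    case (Suc k)
    show ?case
    proof (intro allI impI)
      fix y assume y: "x \<le> y \<and> y \<le> z (Suc k)"
      show "H x \<le> H y"
      proof (cases "y \<le> z k")
        case False
        have "H x \<le> H (z k)" using Suc xz by blast
        also have "\<dots> \<le> H y" using False y by (intro local) (auto simp: zSuc)
        finally show ?thesis .
      qed (use Suc y in blast)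
    qed
  qed (use z0 in auto)
  have a: "0 < real s * \<alpha> + of_int m"
    using step unfolding cell_step_def by (smt (verit) divide_nonneg_nonneg of_nat_0_le_iff)
  \<comment> \<open>The total angle of \<open>k\<close> cells exceeds an integer not below
    \<open>y - x\<close>, so \<open>orbit_order\<close> places the end of the chain beyond the
    translate of \<open>x\<close> by that integer.\<close>
  obtain k :: nat where "of_int \<lceil>y - x\<rceil> / (real s * \<alpha> + of_int m) < real k" using reals_Archimedean2 by blast
  then have "of_int \<lceil>y - x\<rceil> < real k * (real s * \<alpha> + of_int m)" using a by (simp add: field_simps)
  then have "(F ^^ 0) x + of_int \<lceil>y - x\<rceil> < z k"
    unfolding z_def by (intro orbit_order) (simp add: algebra_simps)
  then have "x + of_int \<lceil>y - x\<rceil> < z k" by simp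
  then have "y \<le> z k" by linarith
  then show "H x \<le> H y" using H xy by blast
qed

text \<open>Bounded distortion is applied twice, each time at the cost of
  \<open>exp (7 * V)\<close>. Of the factor 14, 7 is the covering multiplicity of the cells and 2
  accounts for the half of an arc that is lost by trimming.\<close>

definition contraction_rate :: real where
  "contraction_rate = exp (- (14 * V)) / 14"

lemma contraction_rate: "0 < contraction_rate" "contraction_rate < 1"
proof -
  have "exp (- (14 * V)) \<le> 1" using V_nonneg by simp
  then show "contraction_rate < 1" unfolding contraction_rate_def by linarith
qed (simp add: contraction_rate_def)

text \<open>The integrated form of the statement that the iterates of a short interval spend at
  least the share \<open>contraction_rate * (b - a)\<close> of their total length in the arc. The
  images of a whole cell cover the circle and hence the trimmed arc; bounded distortion hands the
  estimate down to a part \<open>[x, y]\<close> of the cell, with \<open>\<theta>\<close> as its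
  share.\<close>

lemma arc_visits_mono:
  assumes step: "cell_step q s m" and mesh: "\<And>x. cell_end s m x - x \<le> (b - a) / 4"
    and ab: "0 \<le> a" "a < b" "b \<le> 1"
  shows "mono (\<lambda>x. (\<Sum>i<q. arc_length a b ((F ^^ i) x)) - contraction_rate * (b - a) * (\<Sum>i<q. (F ^^ i) x))"
proof (rule mono_if_mono_on_cells[OF step])
  fix x y assume xy0: "x \<le> y" "y \<le> cell_end s m x"
  let ?Y = "cell_end s m x" and ?c = contraction_rate
  show "(\<Sum>i<q. arc_length a b ((F ^^ i) x)) - ?c * (b - a) * (\<Sum>i<q. (F ^^ i) x)
    \<le> (\<Sum>i<q. arc_length a b ((F ^^ i) y)) - ?c * (b - a) * (\<Sum>i<q. (F ^^ i) y)"
  proof (cases "x = y")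
    case False
    then have xy: "x < y" "y \<le> ?Y" using xy0 by auto
    \<comment> \<open>The bound on the mesh is also the width of trimming; half of the arc
      remains.\<close>
    define \<eta> where "\<eta> = (b - a) / 4"
    have \<eta>: "0 < \<eta>" unfolding \<eta>_def using ab by simp
    have "4 * \<eta> = b - a" by (simp add: \<eta>_def)
    then have \<eta>2: "a + \<eta> \<le> b - \<eta>" using \<eta> by linarith
    define e where "e = exp (7 * V)"
    define \<theta> where "\<theta> = (y - x) / (?Y - x)"
    have L: "0 < ?Y - x" using cell_end_gt[OF step, of x] by simp
    have e: "e > 0" by (simp add: e_def)
    have \<theta>: "\<theta> > 0" unfolding \<theta>_def using L xy by simp
    define J where "J i = (F ^^ i) y - (F ^^ i) x" for i
    define I where "I i = (F ^^ i) ?Y - (F ^^ i) x" for i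
    define arc where "arc i = arc_length a b ((F ^^ i) y) - arc_length a b ((F ^^ i) x)" for i
    define arc0 where "arc0 i = arc_length (a + \<eta>) (b - \<eta>) ((F ^^ i) ?Y)
      - arc_length (a + \<eta>) (b - \<eta>) ((F ^^ i) x)" for i
    have I: "I i > 0" for i using L unfolding I_def diff_gt_0_iff_gt iter_less_iff .
    have J_le: "J i \<le> e * \<theta> * I i" and J_ge: "\<theta> / e * I i \<le> J i" if "i < q" for i
    proof -
      have "J i * (?Y - x) \<le> e * (I i * (y - x))" "I i * (y - x) \<le> e * (J i * (?Y - x))"
        using cell_ratio[OF step less_imp_le[OF that] xy] by (simp_all only: I_def J_def e_def)
      moreover have "j \<le> e * (d / D) * k" if "j * D \<le> e * (k * d)" "D > 0" for j k d D :: real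
        using that by (simp add: field_simps)
      moreover have "d / D / e * k \<le> j" if "k * d \<le> e * (j * D)" "D > 0" for j k d D :: real
        using that e by (simp add: field_simps)
      ultimately show "J i \<le> e * \<theta> * I i" "\<theta> / e * I i \<le> J i"
        using L unfolding \<theta>_def by blast+
    qed
    have arc_ge: "\<theta> / e * arc0 i \<le> arc i" if "i < q" for i
    proof -
      have "(F ^^ i) ?Y - (F ^^ i) x \<le> \<eta>"
        using mesh[of "(F ^^ i) x"] unfolding iter_cell_end \<eta>_def .
      moreover have "(F ^^ i) y \<le> (F ^^ i) ?Y" using xy(2) unfolding iter_le_iff .
      ultimately have tr: "J i * arc0 i \<le> I i * arc i"
        unfolding J_def I_def arc_def arc0_def using xy0
        by (intro arc_length_trimmed[OF ab(1,3) \<eta> \<eta>2]) auto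
      have "(F ^^ i) x \<le> (F ^^ i) ?Y" using L unfolding iter_le_iff by simp
      then have "arc0 i \<ge> 0"
        unfolding arc0_def using mono_arc_length[of "a + \<eta>" "b - \<eta>"] ab \<eta> \<eta>2 by (auto dest: monoD)
      then have "\<theta> / e * I i * arc0 i \<le> J i * arc0 i" using J_ge[OF that] by (rule mult_right_mono[rotated])
      with tr have "I i * (\<theta> / e * arc0 i) \<le> I i * arc i" by (simp add: mult_ac)
      then show ?thesis unfolding mult_le_cancel_left_pos[OF I] .
    qed
    have "?c * (b - a) * (\<Sum>i<q. J i) \<le> ?c * (b - a) * (\<Sum>i<q. e * \<theta> * I i)"
      using J_le ab contraction_rate by (intro mult_left_mono sum_mono) auto
    also have "\<dots> = ?c * (b - a) * (e * \<theta>) * (\<Sum>i<q. I i)" by (simp add: sum_distrib_left mult_ac)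
    also have "\<dots> \<le> ?c * (b - a) * (e * \<theta>) * 7"
      unfolding I_def using cell_sum_le[OF step, of "\<lambda>t. t" 1 x] ab contraction_rate e \<theta>
      by (intro mult_left_mono) (auto intro: monoI)
    also have "\<dots> = \<theta> / e * ((b - a) / 2)"
    proof -
      have "?c = 1 / (e * e) / 14"
        by (simp add: contraction_rate_def e_def exp_minus inverse_eq_divide flip: exp_add)
      then show ?thesis using e by (simp add: field_simps)
    qed
    also have "(b - a) / 2 \<le> (\<Sum>i<q. arc0 i)"
    proof -
      have "(b - a) / 2 = (b - \<eta>) - (a + \<eta>)" by (simp add: \<eta>_def field_simps)
      also have "\<dots> \<le> (\<Sum>i<q. arc0 i)"
        unfolding arc0_def using ab \<eta> \<eta>2
        by (intro cell_sum_ge[OF step] mono_arc_length arc_length_shift) auto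
      finally show ?thesis .
    qed
    then have "\<theta> / e * ((b - a) / 2) \<le> \<theta> / e * (\<Sum>i<q. arc0 i)"
      using \<theta> e by (intro mult_left_mono) auto
    also have "\<dots> = (\<Sum>i<q. \<theta> / e * arc0 i)" by (rule sum_distrib_left)
    also have "\<dots> \<le> (\<Sum>i<q. arc i)" using arc_ge by (intro sum_mono) auto
    finally show ?thesis by (simp add: J_def arc_def sum_subtractf algebra_simps)
  qed simp
qed

section \<open>Contraction of the variation by averaging\<close>


text \<open>The slopes of an interpolant add up to zero, so subtracting the common lower bound for the
  visits to the grid arcs does not change the Birkhoff sum but decreases its variation.\<close>

lemma variation_interpolant_contracts:
  assumes step: "cell_step q s m" and M: "M > 0" and mesh: "\<And>x. cell_end s m x - x \<le> 1 / (4 * M)"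
    and r: "r 1 = r 0" and w: "(\<Sum>l<M. \<bar>r ((real l + 1) / M) - r (real l / M)\<bar>) \<le> w"
  shows "variation_le (birkhoff q (interpolant r M)) ((1 - contraction_rate) * q * w)"
proof -
  define k where "k l = real M * (r ((real l + 1) / M) - r (real l / M))" for l
  define H where "H l x = (\<Sum>i<q. arc_length (real l / M) ((real l + 1) / M) ((F ^^ i) x))
    - contraction_rate * ((real l + 1) / M - real l / M) * (\<Sum>i<q. (F ^^ i) x)" for l x
  have len: "(real l + 1) / M - real l / M = 1 / M" for l by (simp add: add_divide_distrib)
  have k0: "(\<Sum>l<M. k l) = 0"
    using sum_grid_increments[OF M, of r] r by (simp add: k_def flip: sum_distrib_left)
  have kw: "(\<Sum>l<M. \<bar>k l\<bar>) \<le> M * w"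
    using mult_left_mono[OF w, of "real M"] by (simp add: k_def abs_mult sum_distrib_left)
  \<comment> \<open>A monotone function is its own majorant, so its variation is its degree:
    \<open>q / M\<close>, less the subtracted share.\<close>
  have vH: "variation_le (H l) ((1 - contraction_rate) * q / M)" if l: "l < M" for l
  proof (rule variation_leI[where v = "H l"])
    have "real l / M < (real l + 1) / M" using M by (intro divide_strict_right_mono) auto
    then have "mono (H l)"
      unfolding H_def using mesh l M
      by (intro arc_visits_mono[OF step]) (auto simp: len field_simps)
    then show "\<bar>H l t - H l s\<bar> \<le> H l t - H l s" if "s \<le> t" for s t
      using that by (auto dest: monoD)
    show "H l (t + 1) = H l t + (1 - contraction_rate) * q / M" for t
      unfolding H_def iter_shift arc_length_shift len
      by (simp add: sum.distrib algebra_simps diff_divide_distrib)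
  qed
  have eq: "birkhoff q (interpolant r M) = (\<lambda>x. \<Sum>l<M. k l * H l x)"
  proof
    fix x
    have "birkhoff q (interpolant r M) x
        = (\<Sum>l<M. \<Sum>i<q. k l * arc_length (real l / M) ((real l + 1) / M) ((F ^^ i) x))"
      unfolding birkhoff_def interpolant_def k_def by (rule sum.swap)
    also have "\<dots> = (\<Sum>l<M. k l * H l x + k l * (contraction_rate * (1 / M) * (\<Sum>i<q. (F ^^ i) x)))"
      unfolding H_def len by (simp add: sum_distrib_left algebra_simps)
    also have "\<dots> = (\<Sum>l<M. k l * H l x)"
      unfolding sum.distrib sum_distrib_right[symmetric] k0 by simp
    finally show "birkhoff q (interpolant r M) x = (\<Sum>l<M. k l * H l x)" .
  qed
  have "variation_le (\<lambda>x. \<Sum>l<M. k l * H l x) (\<Sum>l<M. \<bar>k l\<bar> * ((1 - contraction_rate) * q / M))"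
    by (intro variation_le_sum variation_le_cmult vH) auto
  moreover have "(\<Sum>l<M. \<bar>k l\<bar> * ((1 - contraction_rate) * q / M)) \<le> (1 - contraction_rate) * q * w"
  proof -
    have "(\<Sum>l<M. \<bar>k l\<bar> * ((1 - contraction_rate) * q / M))
        = (\<Sum>l<M. \<bar>k l\<bar>) * ((1 - contraction_rate) * q / M)" by (rule sum_distrib_right[symmetric])
    also have "\<dots> \<le> M * w * ((1 - contraction_rate) * q / M)"
      using kw contraction_rate by (intro mult_right_mono) auto
    finally show ?thesis using M by (simp add: mult_ac)
  qed
  ultimately show ?thesis unfolding eq by (rule variation_le_mono)
qed

text \<open>The closure of the Lipschitz functions with respect to variation. This substitute for
  absolute continuity visibly survives averaging: composition with \<open>F ^^ i\<close> keeps
  functions Lipschitz and does not raise the variation.\<close>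

definition approximable :: "(real \<Rightarrow> real) \<Rightarrow> bool" where
  "approximable r \<longleftrightarrow> continuous_on UNIV r \<and> (\<forall>t. r (t + 1) = r t) \<and>
     (\<forall>e>0. \<exists>h C. C-lipschitz_on UNIV h \<and> (\<forall>t. h (t + 1) = h t) \<and> variation_le (\<lambda>t. r t - h t) e)"

lemma variation_birkhoff:
  assumes "variation_le r w"
  shows "variation_le (birkhoff n r) (n * w)"
proof -
  have "variation_le (\<lambda>x. \<Sum>i<n. r ((F ^^ i) x)) (\<Sum>i<n. w)"
    by (intro variation_le_sum variation_le_compose[OF assms mono_iter] iter_shift) auto
  then show ?thesis by (simp add: birkhoff_def[abs_def])
qed

lemma continuous_birkhoff:
  assumes "continuous_on UNIV r"
  shows "continuous_on UNIV (birkhoff n r)"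
  unfolding birkhoff_def[abs_def]
  by (intro continuous_on_sum continuous_on_compose2[OF assms iter_cont] subset_UNIV)

lemma periodic_birkhoff: "(\<And>t. r (t + 1) = r t) \<Longrightarrow> birkhoff n r (t + 1) = birkhoff n r t"
  by (simp add: birkhoff_def iter_shift)

lemma lipschitz_iter: "\<exists>C. C-lipschitz_on UNIV (F ^^ n)"
proof (induction n)
  case 0
  have "1-lipschitz_on UNIV (\<lambda>x::real. x)" by (rule lipschitz_onI) auto
  then show ?case by (auto simp: id_def)
next
  case (Suc n)
  then obtain C where C: "C-lipschitz_on UNIV (F ^^ n)" by blast
  have "bounded (g ` {0..1})"
    by (intro compact_imp_bounded compact_continuous_image continuous_on_subset[OF g_cont]) auto
  then obtain B where "\<forall>y\<in>g ` {0..1}. norm y \<le> B" unfolding bounded_iff by blast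
  then have "\<bar>g t\<bar> \<le> B" if "t \<in> {0..1}" for t using that by auto
  moreover have "g t = g (frac t)" for t
    using periodic_shift_int[of g "frac t" "\<lfloor>t\<rfloor>", OF g_per] by (simp add: frac_def)
  moreover have "frac t \<in> {0..1}" for t :: real using frac_lt_1[of t] by (auto intro: less_imp_le)
  ultimately have B: "g t \<le> B" for t by (metis abs_le_D1)
  have incr: "\<bar>F t - F s\<bar> \<le> exp B * (t - s)" if st: "s < t" for s t
  proof -
    obtain z where "F t - F s = (t - s) * exp (g z)"
      using MVT2[OF st, of F "\<lambda>t. exp (g t)"] lift_deriv by blast
    then show ?thesis using st B[of z] by (simp add: abs_mult mult.commute)
  qed
  have "(exp B)-lipschitz_on UNIV F"
  proof (rule lipschitz_onI)
    fix s t :: real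
    show "dist (F s) (F t) \<le> exp B * dist s t"
      using incr[of s t] incr[of t s]
      by (cases s t rule: linorder_cases) (auto simp: dist_real_def abs_minus_commute)
  qed simp
  then have "(exp B * C)-lipschitz_on UNIV (F \<circ> (F ^^ n))"
    by (intro lipschitz_on_compose[OF C]) (auto intro: lipschitz_on_subset)
  then show ?case by auto
qed

lemma approximable_average:
  assumes "approximable r" "q > 0"
  shows "approximable (\<lambda>x. birkhoff q r x / q)"
  unfolding approximable_def
proof (intro conjI allI impI)
  have r: "continuous_on UNIV r" "\<And>t. r (t + 1) = r t" using assms by (auto simp: approximable_def)
  show "continuous_on UNIV (\<lambda>x. birkhoff q r x / q)"
    using assms(2) by (intro continuous_intros continuous_birkhoff r) auto
  show "birkhoff q r (t + 1) / q = birkhoff q r t / q" for t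
    by (simp add: periodic_birkhoff r)
  fix e :: real assume "e > 0"
  then obtain h C where h: "C-lipschitz_on UNIV h" "\<And>t. h (t + 1) = h t"
    "variation_le (\<lambda>t. r t - h t) e" using assms(1) unfolding approximable_def by meson
  have "\<exists>C. C-lipschitz_on UNIV (\<lambda>x. \<Sum>i<q. (1 / q) * h ((F ^^ i) x))"
  proof (rule lipschitz_sum_cmult)
    fix i
    obtain D where "D-lipschitz_on UNIV (F ^^ i)" using lipschitz_iter by blast
    then have "(C * D)-lipschitz_on UNIV (h \<circ> (F ^^ i))"
      by (intro lipschitz_on_compose) (auto intro: lipschitz_on_subset[OF h(1)])
    then show "\<exists>C. C-lipschitz_on UNIV (\<lambda>x. h ((F ^^ i) x))" by (auto simp: o_def)
  qed simp
  then obtain D where "D-lipschitz_on UNIV (\<lambda>x. birkhoff q h x / q)"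
    by (auto simp: birkhoff_def sum_divide_distrib)
  moreover have "variation_le (\<lambda>x. birkhoff q r x / q - birkhoff q h x / q) e"
  proof -
    have "variation_le (\<lambda>x. 1 / q * birkhoff q (\<lambda>t. r t - h t) x) (\<bar>1 / q\<bar> * (q * e))"
      by (intro variation_le_cmult variation_birkhoff h)
    then show ?thesis using assms(2)
      by (simp add: birkhoff_def sum_subtractf diff_divide_distrib)
  qed
  ultimately show "\<exists>h C. C-lipschitz_on UNIV h \<and> (\<forall>t. h (t + 1) = h t) \<and>
      variation_le (\<lambda>t. birkhoff q r t / q - h t) e"
    using periodic_birkhoff[of h q, OF h(2)] by (intro exI[of _ "\<lambda>x. birkhoff q h x / q"]) auto
qed

text \<open>Split \<open>r\<close> into \<open>r - h\<close>, \<open>h\<close> minus its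
  interpolant, and the interpolant. Averaging does not increase the variation of the two small parts
  and contracts that of the third once the cells are short compared with the grid.\<close>

lemma average_contracts:
  assumes r: "approximable r" and w: "variation_le r w" "w > 0"
  shows "\<exists>q>0. variation_le (\<lambda>x. birkhoff q r x / q) ((1 - contraction_rate / 2) * w)"
proof -
  \<comment> \<open>The parts sum to at most \<open>(1 - contraction_rate) * w + 3 * e\<close>, so
    this \<open>e\<close> spends half of the gain.\<close>
  define e where "e = contraction_rate * w / 6"
  have e: "e > 0" using contraction_rate w by (simp add: e_def)
  obtain h C where h: "C-lipschitz_on UNIV h" "\<And>t. h (t + 1) = h t"
    and rh: "variation_le (\<lambda>t. r t - h t) e" using r e unfolding approximable_def by meson
  have "variation_le (\<lambda>t. r t + (- 1) * (r t - h t)) (w + \<bar>- 1\<bar> * e)"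
    by (intro variation_le_add variation_le_cmult w rh)
  then have hw: "variation_le h (w + e)" by simp
  obtain M where M: "M > 0" and hM: "variation_le (\<lambda>t. h t - interpolant h M t) e"
    using interpolant_approximates[OF lipschitz_on_continuous_on[OF h(1)] h(2) hw
        lipschitz_absolutely_continuous[OF h(1)] e] by blast
  obtain N where N: "\<forall>n\<ge>N. \<forall>s m x. cell_step (den n) s m \<longrightarrow> cell_end s m x - x \<le> 1 / (4 * M)"
    using mesh_tendsto_0[of "1 / (4 * M)"] M by auto
  define q where "q = den N"
  obtain s m where step: "cell_step q s m" using exists_cell_step[OF good_approx_den[of N]] by (auto simp: q_def)
  have q: "q > 0" using step by (simp add: cell_step_def)
  have int: "variation_le (birkhoff q (interpolant h M)) ((1 - contraction_rate) * q * (w + e))"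
    using N step M h(2)[of 0] sum_abs_grid_increments[OF hw M]
    by (intro variation_interpolant_contracts[OF step]) (auto simp: q_def)
  have "variation_le (\<lambda>x. 1 / q * (birkhoff q (\<lambda>t. (r t - h t) + (h t - interpolant h M t)) x
      + birkhoff q (interpolant h M) x)) (\<bar>1 / q\<bar> * (q * (e + e) + (1 - contraction_rate) * q * (w + e)))"
    by (intro variation_le_cmult variation_le_add int variation_birkhoff rh hM)
  moreover have "(\<lambda>x. 1 / q * (birkhoff q (\<lambda>t. (r t - h t) + (h t - interpolant h M t)) x
      + birkhoff q (interpolant h M) x)) = (\<lambda>x. birkhoff q r x / q)"
    by (simp add: birkhoff_def flip: sum.distrib)
  moreover have "\<bar>1 / q\<bar> * (q * (e + e) + (1 - contraction_rate) * q * (w + e))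
      = 2 * e + (1 - contraction_rate) * (w + e)" using q by (simp add: field_simps)
  ultimately have "variation_le (\<lambda>x. birkhoff q r x / q) (2 * e + (1 - contraction_rate) * (w + e))"
    by simp
  moreover have "2 * e + (1 - contraction_rate) * (w + e) \<le> (1 - contraction_rate / 2) * w"
  proof -
    have "contraction_rate * w = 6 * e" by (simp add: e_def)
    moreover have "0 \<le> contraction_rate * e" using contraction_rate e by simp
    ultimately show ?thesis by (simp add: algebra_simps)
  qed
  ultimately show ?thesis using q variation_le_mono by blast
qed

text \<open>Each \<open>birkhoff k r\<close> changes along \<open>F\<close> by
  \<open>r \<circ> F ^^ k - r\<close>; the sum over \<open>k < q\<close> is
  \<open>birkhoff q r - q * r\<close>.\<close>

lemma average_coboundary:
  assumes "q > 0"
  shows "r x = birkhoff q r x / q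
    + (\<Sum>k<q. birkhoff k r x) / q - (\<Sum>k<q. birkhoff k r (F x)) / q"
proof -
  have step: "birkhoff k r (F x) - birkhoff k r x = r ((F ^^ k) x) - r x" for k
    using sum_lessThan_telescope[of "\<lambda>i. r ((F ^^ i) x)" k]
    by (simp add: birkhoff_def sum_subtractf funpow_swap1)
  have "(\<Sum>k<q. birkhoff k r (F x)) - (\<Sum>k<q. birkhoff k r x) = birkhoff q r x - q * r x"
    unfolding sum_subtractf[symmetric] step by (simp add: sum_subtractf birkhoff_def)
  then have "r x = (birkhoff q r x + (\<Sum>k<q. birkhoff k r x) - (\<Sum>k<q. birkhoff k r (F x))) / q"
    using assms by (simp add: eq_divide_eq mult.commute)
  then show ?thesis by (simp add: add_divide_distrib diff_divide_distrib)
qed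

text \<open>The averaging is iterated and the transfer functions are added up. The rate depends on
  \<open>V\<close> only, so the decay is geometric; \<open>V > 0\<close> keeps the bounds positive,
  as \<open>average_contracts\<close> requires.\<close>

lemma small_modulo_coboundary:
  assumes g: "approximable g" and Vpos: "V > 0"
  shows "\<exists>r \<psi>. approximable r \<and> variation_le r ((1 - contraction_rate / 2) ^ n * V) \<and>
    continuous_on UNIV \<psi> \<and> (\<forall>t. \<psi> (t + 1) = \<psi> t) \<and> (\<forall>x. g x = r x + \<psi> x - \<psi> (F x))"
proof (induction n)
  case 0
  show ?case using g g_var by (intro exI[of _ g] exI[of _ "\<lambda>_. 0"]) auto
next
  case (Suc n)
  let ?w = "(1 - contraction_rate / 2) ^ n * V"
  obtain r \<psi> where r: "approximable r" "variation_le r ?w"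
    and \<psi>: "continuous_on UNIV \<psi>" "\<And>t. \<psi> (t + 1) = \<psi> t" "\<And>x. g x = r x + \<psi> x - \<psi> (F x)"
    using Suc by blast
  have "?w > 0" using Vpos contraction_rate by simp
  then obtain q where q: "q > 0"
    "variation_le (\<lambda>x. birkhoff q r x / q) ((1 - contraction_rate / 2) * ?w)"
    using average_contracts[OF r] by blast
  define \<psi>' where "\<psi>' x = \<psi> x + (\<Sum>k<q. birkhoff k r x) / q" for x
  have rc: "continuous_on UNIV r" "\<And>t. r (t + 1) = r t" using r by (auto simp: approximable_def)
  have "continuous_on UNIV \<psi>'"
    unfolding \<psi>'_def[abs_def] using q by (intro continuous_intros \<psi> continuous_birkhoff rc) auto
  moreover have "\<psi>' (t + 1) = \<psi>' t" for t by (simp add: \<psi>'_def \<psi> periodic_birkhoff rc)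
  moreover have "g x = birkhoff q r x / q + \<psi>' x - \<psi>' (F x)" for x
    unfolding \<psi>'_def using \<psi>(3)[of x] average_coboundary[OF q(1), of r x] by linarith
  moreover have "(1 - contraction_rate / 2) * ?w = (1 - contraction_rate / 2) ^ Suc n * V" by simp
  ultimately show ?case using approximable_average[OF r(1) q(1)] q(2)
    by - (rule exI[of _ "\<lambda>x. birkhoff q r x / q"], rule exI[of _ \<psi>'], simp only: simp_thms)
qed

text \<open>Compare \<open>x\<close> with a zero \<open>y\<close> of the Birkhoff sum of
  \<open>g\<close>. The remainder \<open>r\<close> is controlled by Denjoy-Koksma for every
  denominator, the coboundary by uniform continuity of \<open>\<psi>\<close> as the displacement
  vanishes.\<close>

theorem birkhoff_sums_tendsto_0:
  assumes g: "approximable g" and Vpos: "V > 0" and e: "e > 0"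
  shows "\<exists>N. \<forall>n\<ge>N. \<forall>x. \<bar>birkhoff (den n) g x\<bar> < e"
proof -
  have "(\<lambda>n. (1 - contraction_rate / 2) ^ n * V) \<longlonglongrightarrow> 0 * V"
    using contraction_rate by (intro tendsto_intros LIMSEQ_power_zero) auto
  \<comment> \<open>With this bound Denjoy-Koksma costs \<open>7 * e / 14 = e / 2\<close>; the
    coboundary costs \<open>e / 4\<close> at each of \<open>x\<close> and \<open>y\<close>.\<close>
  then have "eventually (\<lambda>n. (1 - contraction_rate / 2) ^ n * V < e / 14) sequentially"
    using e by (intro order_tendstoD(2)) auto
  then obtain k where k: "(1 - contraction_rate / 2) ^ k * V < e / 14"
    unfolding eventually_sequentially by blast
  define w where "w = (1 - contraction_rate / 2) ^ k * V"
  obtain r \<psi> where r: "approximable r" "variation_le r w"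
    and \<psi>: "continuous_on UNIV \<psi>" "\<And>t. \<psi> (t + 1) = \<psi> t" "\<And>x. g x = r x + \<psi> x - \<psi> (F x)"
    using small_modulo_coboundary[OF g Vpos] unfolding w_def by blast
  obtain d where d: "d > 0" "\<And>x y. \<bar>x - y\<bar> < d \<Longrightarrow> \<bar>\<psi> x - \<psi> y\<bar> < e / 4"
    using periodic_uniformly_continuous[OF \<psi>(1,2), of "e / 4"] e by auto
  obtain N where N: "\<forall>n\<ge>N. \<forall>s m x. cell_step (den n) s m \<longrightarrow> cell_end s m x - x \<le> d / 2"
    using mesh_tendsto_0[of "d / 2"] d by auto
  have "\<bar>birkhoff (den n) g x\<bar> < e" if n: "n \<ge> N" for n x
  proof -
    obtain s m where step: "cell_step (den n) s m" using exists_cell_step[OF good_approx_den[of n]] by auto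
    have \<psi>small: "\<bar>\<psi> ((F ^^ den n) z) - \<psi> z\<bar> < e / 4" for z
    proof -
      have "\<bar>(F ^^ den n) z + of_int (- convergent_num \<alpha> n) - z\<bar> \<le> d / 2"
        using N n step by (intro displacement_le_mesh[OF good_approx_den step]) blast
      then have "\<bar>(F ^^ den n) z + of_int (- convergent_num \<alpha> n) - z\<bar> < d" using d by linarith
      from d(2)[OF this] show ?thesis unfolding periodic_shift_int[of \<psi>, OF \<psi>(2)] .
    qed
    have sum: "birkhoff (den n) g z = birkhoff (den n) r z - (\<psi> ((F ^^ den n) z) - \<psi> z)" for z
    proof -
      have "birkhoff (den n) g z = (\<Sum>i<den n. r ((F ^^ i) z) - (\<psi> ((F ^^ Suc i) z) - \<psi> ((F ^^ i) z)))"
        by (simp add: birkhoff_def \<psi>(3) algebra_simps)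
      also have "\<dots> = birkhoff (den n) r z - (\<Sum>i<den n. \<psi> ((F ^^ Suc i) z) - \<psi> ((F ^^ i) z))"
        unfolding sum_subtractf[of "\<lambda>i. r ((F ^^ i) z)"] birkhoff_def ..
      also have "(\<Sum>i<den n. \<psi> ((F ^^ Suc i) z) - \<psi> ((F ^^ i) z)) = \<psi> ((F ^^ den n) z) - \<psi> z"
        using sum_lessThan_telescope[of "\<lambda>i. \<psi> ((F ^^ i) z)" "den n"] by (simp only: funpow_0)
      finally show ?thesis .
    qed
    obtain y where y: "birkhoff (den n) g y = 0" using birkhoff_zero by blast
    have "r (t + 1) = r t" for t using r by (simp add: approximable_def)
    then have "\<bar>birkhoff (den n) r x - birkhoff (den n) r y\<bar> \<le> 7 * w"
      unfolding birkhoff_def by (rule denjoy_koksma[OF good_approx_den r(2)])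
    then show ?thesis using k[folded w_def] \<psi>small[of x] \<psi>small[of y] sum[of x] sum[of y] y by linarith
  qed
  then show ?thesis by blast
qed

theorem displacement_tendsto_0:
  assumes "e > 0"
  shows "\<exists>N. \<forall>n\<ge>N. \<forall>x. \<bar>(F ^^ den n) x + of_int (- convergent_num \<alpha> n) - x\<bar> < e"
proof -
  obtain N where N: "\<forall>n\<ge>N. \<forall>s m x. cell_step (den n) s m \<longrightarrow> cell_end s m x - x \<le> e / 2"
    using mesh_tendsto_0[of "e / 2"] assms by auto
  have "\<bar>(F ^^ den n) x + of_int (- convergent_num \<alpha> n) - x\<bar> < e" if "n \<ge> N" for n x
  proof -
    obtain s m where step: "cell_step (den n) s m" using exists_cell_step[OF good_approx_den[of n]] by auto
    have "\<bar>(F ^^ den n) x + of_int (- convergent_num \<alpha> n) - x\<bar> \<le> e / 2"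
      using N that step by (intro displacement_le_mesh[OF good_approx_den step]) blast
    then show ?thesis using assms by linarith
  qed
  then show ?thesis by blast
qed

lemma approximable_if_absolutely_continuous:
  assumes "absolutely_continuous_on 0 1 g"
  shows "approximable g"
  unfolding approximable_def
proof (intro conjI allI impI g_cont g_per)
  fix e :: real assume "e > 0"
  then obtain M where M: "M > 0" "variation_le (\<lambda>t. g t - interpolant g M t) e"
    using interpolant_approximates[OF g_cont g_per g_var assms] by blast
  then show "\<exists>h C. C-lipschitz_on UNIV h \<and> (\<forall>t. h (t + 1) = h t) \<and> variation_le (\<lambda>t. g t - h t) e"
    using lipschitz_interpolant[of g M] interpolant_shift[of g M] g_per[of 0] by auto
qed

end

section \<open>Lifts of circle diffeomorphisms\<close>

text \<open>If the degree were 2 or more, \<open>F\<close> would reach \<open>F 0 + 1\<close>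
  strictly inside the period, against injectivity of \<open>f\<close>.\<close>

lemma lift_degree_one:
  assumes F: "is_lift F f" and mono: "strict_mono F" and inj: "inj f"
  shows "F (t + 1) = F t + 1"
proof -
  have lift: "to_circle (F t) = f (to_circle t)" for t using F by (simp add: is_lift_def)
  obtain c where c: "c \<in> \<int>" "\<And>t. F (t + 1) = F t + c" using lift_shift_unique[OF F F, of 1] by auto
  have "F 0 < F 1" using mono by (simp add: strict_mono_less)
  then have "c > 0" using c(2)[of 0] by simp
  then have c1: "c \<ge> 1" using Ints_nonzero_abs_ge1[OF c(1)] by simp
  have "c = 1"
  proof (rule ccontr)
    assume "c \<noteq> 1"
    then have "F 0 + 1 < F 1" using c1 c(2)[of 0] by simp
    moreover have "continuous_on {0..1} F" using F by (auto simp: is_lift_def intro: continuous_on_subset)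
    ultimately obtain x where x: "0 \<le> x" "x \<le> 1" "F x = F 0 + 1"
      using IVT'[of F 0 "F 0 + 1" 1] by auto
    then have "f (to_circle x) = f (to_circle 0)" by (simp flip: lift add: to_circle_eq_iff)
    then have "x \<in> \<int>" using inj by (simp add: inj_eq to_circle_eq_iff)
    moreover have "x \<noteq> 0" "x \<noteq> 1" using x \<open>F 0 + 1 < F 1\<close> by auto
    ultimately show False using x by (auto elim!: Ints_cases)
  qed
  then show ?thesis using c by simp
qed

lemma is_lift_funpow:
  assumes "is_lift F f"
  shows "is_lift (F ^^ n) (f ^^ n)"
proof (induction n)
  case (Suc n)
  have "continuous_on UNIV F" "continuous_on UNIV (F ^^ n)" using assms Suc by (auto simp: is_lift_def)
  then have "continuous_on UNIV (\<lambda>t. F ((F ^^ n) t))"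
    by (rule continuous_on_compose2) simp
  then show ?case using assms Suc by (simp add: is_lift_def o_def)
qed (simp add: is_lift_def id_def)

lemma is_lift_id: "is_lift id id"
  by (simp add: is_lift_def id_def)

lemma is_lift_add_int:
  assumes "is_lift F f"
  shows "is_lift (\<lambda>t. F t + of_int c) f"
proof -
  have "to_circle (F t + of_int c) = to_circle (F t)" for t by (simp add: to_circle_eq_iff)
  then show ?thesis using assms by (auto simp: is_lift_def intro: continuous_intros)
qed

lemma (in circle_lift) iter_translate:
  "((\<lambda>t. F t + of_int c) ^^ n) t = (F ^^ n) t + real n * of_int c"
proof (induction n)
  case (Suc n)
  have "F ((F ^^ n) t + of_int (int n * c)) = F ((F ^^ n) t) + of_int (int n * c)"
    using iter_shift_int[of 1 "(F ^^ n) t" "int n * c"] by (simp del: of_int_mult)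
  then show ?case using Suc by (simp add: algebra_simps)
qed simp

lemma (in circle_lift) translate_limit:
  assumes "(\<lambda>n. (F ^^ n) t / real n) \<longlonglongrightarrow> \<tau>"
  shows "(\<lambda>n. ((\<lambda>t. F t + of_int c) ^^ n) t / real n) \<longlonglongrightarrow> \<tau> + of_int c"
proof (rule Lim_transform_eventually)
  show "(\<lambda>n. (F ^^ n) t / real n + of_int c) \<longlonglongrightarrow> \<tau> + of_int c"
    by (intro tendsto_intros assms)
  show "\<forall>\<^sub>F n in sequentially. (F ^^ n) t / real n + of_int c = ((\<lambda>t. F t + of_int c) ^^ n) t / real n"
    unfolding iter_translate
    by (auto intro!: eventually_sequentiallyI[of 1] simp: field_simps)
qed

text \<open>Any other lift differs by an integer translation, which moves the limit by that integer
  and leaves its fractional part unchanged.\<close>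

lemma (in circle_lift) rotation_number_eq:
  assumes F: "is_lift F f" and \<tau>: "\<And>t. (\<lambda>n. (F ^^ n) t / real n) \<longlonglongrightarrow> \<tau>"
  shows "rotation_number f = frac \<tau>"
  unfolding rotation_number_def
proof (rule the_equality)
  show "\<exists>G \<sigma>. is_lift G f \<and> (\<forall>t. (\<lambda>n. (G ^^ n) t / real n) \<longlonglongrightarrow> \<sigma>) \<and> frac \<tau> = frac \<sigma>"
    using F \<tau> by blast
next
  fix \<rho> assume "\<exists>G \<sigma>. is_lift G f \<and> (\<forall>t. (\<lambda>n. (G ^^ n) t / real n) \<longlonglongrightarrow> \<sigma>) \<and> \<rho> = frac \<sigma>"
  then obtain G \<sigma> where G: "is_lift G f" and \<sigma>: "\<And>t. (\<lambda>n. (G ^^ n) t / real n) \<longlonglongrightarrow> \<sigma>" and \<rho>: "\<rho> = frac \<sigma>"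
    by blast
  obtain c where "c \<in> \<int>" "\<And>t. G (t + 0) = F t + c" using lift_shift_unique[OF F G, of 0] by auto
  then obtain k where "G = (\<lambda>t. F t + of_int k)" by (auto elim!: Ints_cases)
  then have "(\<lambda>n. (G ^^ n) 0 / real n) \<longlonglongrightarrow> \<tau> + of_int k" using translate_limit[OF \<tau>] by simp
  then have "\<sigma> = \<tau> + of_int k" using \<sigma>[of 0] LIMSEQ_unique by blast
  then show "\<rho> = frac \<tau>" by (simp add: \<rho> frac_def)
qed

text \<open>For a lift \<open>H\<close> of the inverse, \<open>H \<circ> F\<close> is a translation,
  so the derivative of \<open>F\<close> cannot vanish; monotonicity excludes negative
  values.\<close>

lemma diffeo_lift_derivative:
  assumes f: "C1_circle_diffeo f" and F: "is_lift F f" and mono: "strict_mono F"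
  obtains D where "\<And>t. (F has_real_derivative D t) (at t)" "continuous_on UNIV D" "\<And>t. D t > 0"
proof -
  have bij: "bij f" and C1: "C1_circle_map f" "C1_circle_map (inv f)" using f by (auto simp: C1_circle_diffeo_def)
  obtain G where G: "is_lift G f" "G C1_differentiable_on UNIV" using C1 by (auto simp: C1_circle_map_def)
  then obtain D where D: "\<And>t. (G has_real_derivative D t) (at t)" "continuous_on UNIV D"
    unfolding C1_differentiable_on_def has_real_derivative_iff_has_vector_derivative by auto
  obtain c where "\<And>t. F (t + 0) = G t + c" using lift_shift_unique[OF G(1) F, of 0] by auto
  then have "F = (\<lambda>t. G t + c)" by auto
  then have FD: "(F has_real_derivative D t) (at t)" for t
    using D(1) by (auto intro!: derivative_eq_intros)
  obtain H where H: "is_lift H (inv f)" "H C1_differentiable_on UNIV" using C1 by (auto simp: C1_circle_map_def)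
  then obtain E where E: "\<And>t. (H has_real_derivative E t) (at t)"
    unfolding C1_differentiable_on_def has_real_derivative_iff_has_vector_derivative by auto
  have "continuous_on UNIV H" "continuous_on UNIV F" using H(1) F by (auto simp: is_lift_def)
  then have "continuous_on UNIV (\<lambda>t. H (F t))" by (rule continuous_on_compose2) simp
  moreover have "to_circle (H (F t)) = to_circle t" for t
    using F H(1) bij by (simp add: is_lift_def bij_is_inj)
  ultimately have "is_lift (\<lambda>t. H (F t)) id" by (simp add: is_lift_def)
  then obtain k where "\<And>t. H (F (t + 0)) = id t + k" using lift_shift_unique[OF is_lift_id, of _ 0] by auto
  then have HF: "(\<lambda>t. H (F t)) = (\<lambda>t. t + k)" by auto
  have "D t > 0" for t
  proof -
    have "((\<lambda>t. H (F t)) has_real_derivative E (F t) * D t) (at t)"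
      by (rule DERIV_chain2[OF E FD])
    moreover have "((\<lambda>t. t + k) has_real_derivative 1) (at t)" by (auto intro!: derivative_eq_intros)
    ultimately have "E (F t) * D t = 1" unfolding HF by (rule DERIV_unique)
    then have "D t \<noteq> 0" by auto
    moreover have "\<not> D t < 0"
    proof
      assume "D t < 0"
      then obtain d where d: "d > 0" "\<And>h. h > 0 \<Longrightarrow> h < d \<Longrightarrow> F (t + h) < F t"
        using DERIV_neg_dec_right[OF FD] by blast
      then have "F (t + d / 2) < F t" by simp
      then show False using d mono by (simp add: strict_mono_less)
    qed
    ultimately show ?thesis by linarith
  qed
  then show thesis using that FD D(2) by blast
qed

text \<open>The hypothesis concerns the derivative, the argument its logarithm; \<open>ln\<close> is
  Lipschitz with constant \<open>1 / m\<close> above \<open>m\<close>.\<close>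

lemma absolutely_continuous_ln:
  assumes ac: "absolutely_continuous_on 0 1 D" and m: "m > 0" "\<And>t. t \<in> {0..1} \<Longrightarrow> m \<le> D t"
  shows "absolutely_continuous_on 0 1 (\<lambda>t. ln (D t))"
  unfolding absolutely_continuous_on_def
proof (intro allI impI)
  fix e :: real assume "e > 0"
  then have "e * m > 0" using m by simp
  then obtain \<delta> where \<delta>: "\<delta> > 0" "\<And>(n::nat) u v. (\<forall>i<n. 0 \<le> u i \<and> u i \<le> v i \<and> v i \<le> 1) \<and>
      disjoint_family_on (\<lambda>i. {u i<..<v i}) {..<n} \<and> (\<Sum>i<n. v i - u i) < \<delta> \<Longrightarrow>
      (\<Sum>i<n. \<bar>D (v i) - D (u i)\<bar>) < e * m"
    using ac unfolding absolutely_continuous_on_def by meson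
  have ln_le: "ln y - ln x \<le> \<bar>y - x\<bar> / m" if "m \<le> x" "m \<le> y" for x y :: real
  proof -
    have "ln y - ln x = ln (y / x)" using that m by (simp add: ln_div)
    also have "\<dots> \<le> y / x - 1" using that m by (intro ln_le_minus_one) auto
    also have "\<dots> = (y - x) / x" using that m by (simp add: field_simps)
    also have "\<dots> \<le> \<bar>y - x\<bar> / x" using that m by (intro divide_right_mono) auto
    also have "\<dots> \<le> \<bar>y - x\<bar> / m" using that m by (intro divide_left_mono) auto
    finally show ?thesis .
  qed
  then have ln_lipschitz: "\<bar>ln y - ln x\<bar> \<le> \<bar>y - x\<bar> / m" if "m \<le> x" "m \<le> y" for x y :: real
    using ln_le[of x y] ln_le[of y x] that by (simp add: abs_le_iff abs_minus_commute)
  show "\<exists>\<delta>>0. \<forall>(n::nat) u v. (\<forall>i<n. 0 \<le> u i \<and> u i \<le> v i \<and> v i \<le> 1) \<and>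
      disjoint_family_on (\<lambda>i. {u i<..<v i}) {..<n} \<and> (\<Sum>i<n. v i - u i) < \<delta> \<longrightarrow>
      (\<Sum>i<n. \<bar>ln (D (v i)) - ln (D (u i))\<bar>) < e"
  proof (intro exI[of _ \<delta>] conjI \<delta>(1) allI impI)
    fix n :: nat and u v :: "nat \<Rightarrow> real"
    assume *: "(\<forall>i<n. 0 \<le> u i \<and> u i \<le> v i \<and> v i \<le> 1) \<and>
      disjoint_family_on (\<lambda>i. {u i<..<v i}) {..<n} \<and> (\<Sum>i<n. v i - u i) < \<delta>"
    have "(\<Sum>i<n. \<bar>ln (D (v i)) - ln (D (u i))\<bar>) \<le> (\<Sum>i<n. \<bar>D (v i) - D (u i)\<bar> / m)"
    proof (intro sum_mono ln_lipschitz m(2))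
      fix i assume "i \<in> {..<n}"
      then have "0 \<le> u i" "u i \<le> v i" "v i \<le> 1" using * by auto
      then show "u i \<in> {0..1}" "v i \<in> {0..1}" by auto
    qed
    also have "\<dots> = (\<Sum>i<n. \<bar>D (v i) - D (u i)\<bar>) / m" by (simp add: sum_divide_distrib)
    also have "\<dots> < e" using \<delta>(2)[OF *] m by (simp add: pos_divide_less_eq)
    finally show "(\<Sum>i<n. \<bar>ln (D (v i)) - ln (D (u i))\<bar>) < e" .
  qed
qed

lemma C1_tendsto_Suc: "C1_tendsto u h \<Longrightarrow> C1_tendsto (\<lambda>n. u (Suc n)) h"
  unfolding C1_tendsto_def uniform_limit_iff
  using eventually_sequentially_Suc[where P = "\<lambda>n. \<forall>x\<in>UNIV. dist (u n x) (h x) < e" for e]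
    eventually_sequentially_Suc[where P = "\<lambda>n. \<forall>x\<in>UNIV. dist (circle_deriv (u n) x) (circle_deriv h x) < e" for e]
  by simp

lemma circle_deriv_id: "circle_deriv id z = 1"
proof -
  obtain t where "z = to_circle t" using to_circle_surj by metis
  then show ?thesis using circle_deriv_eq[OF is_lift_id, of 1 t] by (simp add: id_def)
qed

lemma abs_exp_minus_one_less:
  fixes s e :: real
  assumes "\<bar>s\<bar> < ln (1 + e)" "e > 0"
  shows "\<bar>exp s - 1\<bar> < e"
proof -
  have "exp s < exp (ln (1 + e))" "exp (- s) < exp (ln (1 + e))" using assms unfolding exp_less_cancel_iff by linarith+
  then have "exp s < 1 + e" "exp (- s) < 1 + e" using assms by simp_all
  moreover from this have "1 < exp s * (1 + e)" by (simp add: exp_minus field_simps)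
  moreover have "(1 - e) * (1 + e) \<le> 1" by (simp add: algebra_simps)
  ultimately have "(1 - e) * (1 + e) < exp s * (1 + e)" by linarith
  then have "1 - e < exp s" using assms by simp
  with \<open>exp s < 1 + e\<close> show ?thesis by linarith
qed

theorem corollary2:
  fixes f :: "circle \<Rightarrow> circle"
  assumes "C1_bv_diffeo f"
    and "orientation_preserving f"
    and "rotation_number f \<notin> \<rat>"
    and "circle_absolutely_continuous (circle_deriv f)"
  shows "C1_rigid f \<and>
    C1_tendsto (\<lambda>n. f ^^ convergent_denom (rotation_number f) n) id"
proof -
  define \<alpha> where "\<alpha> = rotation_number f"
  have diffeo: "C1_circle_diffeo f" and bv: "circle_bounded_variation (\<lambda>z. ln (circle_deriv f z))"
    using assms(1) by (auto simp: C1_bv_diffeo_def)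
  have inj: "inj f" using diffeo by (auto simp: C1_circle_diffeo_def bij_is_inj)
  obtain F0 where F0: "is_lift F0 f" "strict_mono F0" using assms(2) by (auto simp: orientation_preserving_def)
  interpret F0: circle_lift F0
    by standard (use F0(2) lift_degree_one[OF F0 inj] in auto)
  obtain \<tau> where \<tau>: "\<And>t. (\<lambda>n. (F0 ^^ n) t / real n) \<longlonglongrightarrow> \<tau>" using F0.rotation_limit_exists by blast
  \<comment> \<open>This lift has translation number \<open>\<alpha>\<close> itself, the
    representative in \<open>[0, 1)\<close>, so its convergents are those of the claim.\<close>
  define F where "F t = F0 t + of_int (- \<lfloor>\<tau>\<rfloor>)" for t
  have F: "is_lift F f" unfolding F_def[abs_def] by (rule is_lift_add_int[OF F0(1)])
  have F_mono: "strict_mono F" using F0(2) by (simp add: F_def strict_mono_def)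
  have "\<alpha> = \<tau> + of_int (- \<lfloor>\<tau>\<rfloor>)"
    unfolding \<alpha>_def using F0.rotation_number_eq[OF F0(1) \<tau>] by (simp add: frac_def)
  then have lim: "(\<lambda>n. (F ^^ n) t / real n) \<longlonglongrightarrow> \<alpha>" for t
    using F0.translate_limit[OF \<tau>[of t], of "- \<lfloor>\<tau>\<rfloor>"] by (simp add: F_def[abs_def])
  obtain D where D: "\<And>t. (F has_real_derivative D t) (at t)" "continuous_on UNIV D" "\<And>t. D t > 0"
    using diffeo_lift_derivative[OF diffeo F F_mono] by blast
  have cD: "circle_deriv f (to_circle t) = D t" for t by (rule circle_deriv_eq[OF F D(1)])
  define g where "g t = ln (D t)" for t
  have gper: "g (t + 1) = g t" for t
  proof -
    have "to_circle (t + 1) = to_circle t" by (simp add: to_circle_eq_iff)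
    then show ?thesis unfolding g_def cD[symmetric] by simp
  qed
  obtain B where B: "\<And>(n::nat) t. mono_on {..n} t \<and> t ` {..n} \<subseteq> {0..1} \<Longrightarrow>
      (\<Sum>i<n. \<bar>g (t (Suc i)) - g (t i)\<bar>) \<le> B"
    using bv unfolding circle_bounded_variation_def bounded_variation_on_def cD g_def by blast
  have var: "variation_le g B" by (rule variation_le_of_partitions) (use gper B in auto)
  \<comment> \<open>The contraction argument asks for a strictly positive bound, while
    \<open>B\<close> can be 0, as for a rotation.\<close>
  define V where "V = B + 1"
  have V: "V > 0" using variation_le_nonneg[OF var] by (simp add: V_def)
  interpret denjoy_lift F \<alpha> g V
  proof
    show "variation_le g V" using var by (rule variation_le_mono) (simp add: V_def)
    show "continuous_on UNIV g"
      unfolding g_def[abs_def] using D(2) D(3) by (intro continuous_on_ln) (auto simp: less_imp_neq[symmetric])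
    show "(F has_real_derivative exp (g t)) (at t)" for t using D(1,3) by (simp add: g_def)
    show "F (t + 1) = F t + 1" for t by (rule lift_degree_one[OF F F_mono inj])
  qed (use F_mono lim assms(3) gper in \<open>auto simp: \<alpha>_def\<close>)
  have ac: "absolutely_continuous_on 0 1 g"
  proof -
    have "absolutely_continuous_on 0 1 D"
      using assms(4) by (simp add: circle_absolutely_continuous_def cD)
    moreover have "\<exists>t0\<in>{0..1}. \<forall>t\<in>{0..1}. D t0 \<le> D t"
      by (intro continuous_attains_inf continuous_on_subset[OF D(2)]) auto
    then obtain t0 where "\<And>t. t \<in> {0..1} \<Longrightarrow> D t0 \<le> D t" by blast
    ultimately show ?thesis unfolding g_def[abs_def] by (rule absolutely_continuous_ln[OF _ D(3)])
  qed
  have deriv: "circle_deriv (f ^^ n) (to_circle t) = exp (birkhoff n g t)" for n t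
    by (rule circle_deriv_eq[OF is_lift_funpow[OF F] iter_deriv])
  have tendsto: "C1_tendsto (\<lambda>n. f ^^ den n) id"
    unfolding C1_tendsto_def uniform_limit_iff eventually_sequentially
  proof (intro conjI allI impI)
    fix e :: real assume e: "e > 0"
    obtain N where N: "\<And>n x. n \<ge> N \<Longrightarrow> \<bar>(F ^^ den n) x + of_int (- convergent_num \<alpha> n) - x\<bar> < e"
      using displacement_tendsto_0[OF e] by blast
    have "dist ((f ^^ den n) z) (id z) < e" if n: "n \<ge> N" for n z
    proof -
      obtain t where t: "z = to_circle t" using to_circle_surj by metis
      have "(f ^^ den n) z = to_circle ((F ^^ den n) t)"
        using is_lift_funpow[OF F] by (simp add: is_lift_def t)
      then have "dist ((f ^^ den n) z) (id z) = dist_to_int ((F ^^ den n) t - t)"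
        by (simp add: t dist_circle.abs_eq)
      also have "\<dots> \<le> \<bar>(F ^^ den n) t - t - of_int (convergent_num \<alpha> n)\<bar>" by (rule dist_to_int_le)
      also have "\<dots> < e" using N[OF n, of t] by (simp add: algebra_simps)
      finally show ?thesis .
    qed
    then show "\<exists>N. \<forall>n\<ge>N. \<forall>x\<in>UNIV. dist ((f ^^ den n) x) (id x) < e" by blast
    have "ln (1 + e) > 0" using e by simp
    then obtain N' where N': "\<And>n x. n \<ge> N' \<Longrightarrow> \<bar>birkhoff (den n) g x\<bar> < ln (1 + e)"
      using birkhoff_sums_tendsto_0[OF approximable_if_absolutely_continuous[OF ac] V] by blast
    have "dist (circle_deriv (f ^^ den n) z) (circle_deriv id z) < e" if n: "n \<ge> N'" for n z
    proof -
      obtain t where t: "z = to_circle t" using to_circle_surj by metis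
      show ?thesis
        using abs_exp_minus_one_less[OF N'[OF n, of t] e] by (simp add: t deriv circle_deriv_id dist_real_def)
    qed
    then show "\<exists>N. \<forall>n\<ge>N. \<forall>x\<in>UNIV. dist (circle_deriv (f ^^ den n) x) (circle_deriv id x) < e" by blast
  qed
  \<comment> \<open>Rigidity asks for strictly increasing exponents, and the denominators of index 0
    and 1 can coincide; hence the shift by one.\<close>
  have "C1_rigid f"
    unfolding C1_rigid_def
    using C1_tendsto_Suc[OF tendsto] strict_mono_convergent_denom[OF irrational]
    by (intro exI[of _ "\<lambda>n. den (Suc n)"] conjI)
  then show ?thesis using tendsto by (simp add: \<alpha>_def)
qed

end
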